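(* Let $\tau\in\mathbb C$ with $\operatorname{Im}(\tau)>0$ satisfy $w\tau^2+u\tau+v=0$, where $u,v,w\in\mathbb Z$, $w>0$, $\gcd(u,v,w)=1$ and $u^2-4vw<0$. Let $\Lambda=\mathbb Z^3+\tau\mathbb Z^3\subset\mathbb C^3$, and for $\lambda\in\Lambda$ put $\bar\lambda:=w\tau\lambda\in\Lambda$. Then the bivectors in $\Lambda\wedge\Lambda$ of the form $\frac1r(\lambda\wedge\bar\lambda)$, where $\lambda\in\Lambda$ is primitive and $r$ is the integral content of $\lambda\wedge\bar\lambda$, correspond bijectively to the primitive vectors $(\alpha,\beta,\gamma,\delta,\epsilon,\zeta,\eta,\theta,\iota)\in\mathbb Z^9$ with $\alpha,\beta,\gamma\ge0$ satisfying $$\alpha\beta-\delta(\delta+u\eta)=vw\,\eta^2,\qquad \beta\gamma-\zeta(\zeta+u\iota)=vw\,\iota^2,\qquad \alpha\gamma-\epsilon(\epsilon+u\theta)=vw\,\theta^2$$ and $$2\alpha\beta\gamma=\delta(\epsilon+u\theta)\zeta+(\delta+u\eta)\epsilon(\zeta+u\iota)+vw\big((2\delta+u\eta)\theta\iota-(2\epsilon+u\theta)\eta\iota+(2\zeta+u\iota)\eta\theta\big).$$ The correspondence sends $\frac1r(\lambda\wedge\bar\lambda)$, with $\lambda=(a+\tau d,\;b+\tau e,\;c+\tau f)$, $a,b,c,d,e,f\in\mathbb Z$, to the vector given by $$\begin{aligned} r\alpha&=wa^2-uad+vd^2, & r\beta&=wb^2-ube+ve^2, & r\gamma&=wc^2-ucf+vf^2,\\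 r\delta&=wab-uae+vde, & r\epsilon&=wac-uaf+vdf, & r\zeta&=wbc-ubf+vef,\\ r\eta&=ae-bd, & r\theta&=af-cd, & r\iota&=bf-ce. \end{aligned}$$
   Context: $\Lambda$ is regarded as a free $\mathbb Z$-module of rank 6, and $\Lambda\wedge\Lambda$ is its second exterior power over $\mathbb Z$ (free of rank 15). The integral content of a nonzero element $x$ of a free $\mathbb Z$-module is the largest positive integer $r$ such that $x$ is $r$ times an element of the module; $x$ is primitive if its content is $1$. Because $w\tau\cdot 1=w\tau$ and $w\tau\cdot\tau=-v-u\tau$, multiplication by $w\tau$ maps $\Lambda$ into itself, so $\bar\lambda\in\Lambda$ (this bar is not complex conjugation). *)

theory Defs
  imports "HOL-Analysis.Analysis" "HOL-Algebra.Free_Abelian_Groups"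
begin

(* Z-modules are abelian groups of HOL-Algebra. Since its group notation is multiplicative, the
   multiple n x of an element is written x [^] n below, also when the operation is (+). *)

definition additive_group :: "'a::ab_group_add set \<Rightarrow> 'a monoid" where
  "additive_group S = \<lparr>carrier = S, monoid.mult = (+), one = 0\<rparr>"

(* Meaningful for nonzero elements of a free module only: otherwise the set of such r can be
   unbounded. *)
definition integral_content :: "('a, 'b) monoid_scheme \<Rightarrow> 'a \<Rightarrow> nat" where
  "integral_content G x = (GREATEST r. r > 0 \<and> (\<exists>y\<in>carrier G. x = y [^]\<^bsub>G\<^esub> r))"

definition primitive :: "('a, 'b) monoid_scheme \<Rightarrow> 'a \<Rightarrow> bool" where
  "primitive G x \<longleftrightarrow> x \<in> carrier G \<and> x \<noteq> \<one>\<^bsub>G\<^esub> \<and> integral_content G x = 1"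

(* (1/r) x, well defined in a torsion-free group if x is divisible by r. *)
definition exact_quotient :: "('a, 'b) monoid_scheme \<Rightarrow> 'a \<Rightarrow> nat \<Rightarrow> 'a" where
  "exact_quotient G x r = (THE y. y \<in> carrier G \<and> y [^]\<^bsub>G\<^esub> r = x)"

(* The exterior square over Z is the free abelian group on pairs modulo biadditivity
   and (x, x) = 0. The minus sign is subtraction of formal integer combinations. *)
definition wedge_relations :: "('a, 'b) monoid_scheme \<Rightarrow> ('a \<times> 'a \<Rightarrow>\<^sub>0 int) set" where
  "wedge_relations G =
     {frag_of (x \<otimes>\<^bsub>G\<^esub> y, z) - frag_of (x, z) - frag_of (y, z) | x y z.
        x \<in> carrier G \<and> y \<in> carrier G \<and> z \<in> carrier G}
   \<union> {frag_of (z, x \<otimes>\<^bsub>G\<^esub> y) - frag_of (z, x) - frag_of (z, y) | x y z.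
        x \<in> carrier G \<and> y \<in> carrier G \<and> z \<in> carrier G}
   \<union> {frag_of (x, x) | x. x \<in> carrier G}"

definition wedge_kernel :: "('a, 'b) monoid_scheme \<Rightarrow> ('a \<times> 'a \<Rightarrow>\<^sub>0 int) set" where
  "wedge_kernel G = generate (free_Abelian_group (carrier G \<times> carrier G)) (wedge_relations G)"

definition exterior_square :: "('a, 'b) monoid_scheme \<Rightarrow> ('a \<times> 'a \<Rightarrow>\<^sub>0 int) set monoid" where
  "exterior_square G = free_Abelian_group (carrier G \<times> carrier G) Mod wedge_kernel G"

definition wedge :: "('a, 'b) monoid_scheme \<Rightarrow> 'a \<Rightarrow> 'a \<Rightarrow> ('a \<times> 'a \<Rightarrow>\<^sub>0 int) set" where
  "wedge G x y =
     wedge_kernel G #>\<^bsub>free_Abelian_group (carrier G \<times> carrier G)\<^esub> frag_of (x, y)"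

(* Z^3 + tau Z^3 inside C^3 *)
definition Lattice :: "complex \<Rightarrow> (complex ^ 3) monoid" where
  "Lattice \<tau> = additive_group
     {(\<chi> i. of_int (m $ i) + \<tau> * of_int (n $ i)) | m n :: int ^ 3. True}"

definition bar :: "int \<Rightarrow> complex \<Rightarrow> complex ^ 3 \<Rightarrow> complex ^ 3" where
  "bar w \<tau> x = (of_int w * \<tau>) *s x"

definition bar_bivector :: "int \<Rightarrow> complex \<Rightarrow> complex ^ 3 \<Rightarrow> ((complex ^ 3) \<times> (complex ^ 3) \<Rightarrow>\<^sub>0 int) set" where
  "bar_bivector w \<tau> x = wedge (Lattice \<tau>) x (bar w \<tau> x)"

definition bar_content :: "int \<Rightarrow> complex \<Rightarrow> complex ^ 3 \<Rightarrow> nat" where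
  "bar_content w \<tau> x = integral_content (exterior_square (Lattice \<tau>)) (bar_bivector w \<tau> x)"

definition reduced_bivector :: "int \<Rightarrow> complex \<Rightarrow> complex ^ 3 \<Rightarrow> ((complex ^ 3) \<times> (complex ^ 3) \<Rightarrow>\<^sub>0 int) set" where
  "reduced_bivector w \<tau> x =
     exact_quotient (exterior_square (Lattice \<tau>)) (bar_bivector w \<tau> x) (bar_content w \<tau> x)"

type_synonym int9 = "int \<times> int \<times> int \<times> int \<times> int \<times> int \<times> int \<times> int \<times> int"

definition parameter_vectors :: "int \<Rightarrow> int \<Rightarrow> int \<Rightarrow> int9 set" where
  "parameter_vectors u v w =
     {(\<alpha>, \<beta>, \<gamma>, \<delta>, \<epsilon>, \<zeta>, \<eta>, \<theta>, \<iota>).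
        primitive (additive_group UNIV) (\<alpha>, \<beta>, \<gamma>, \<delta>, \<epsilon>, \<zeta>, \<eta>, \<theta>, \<iota>) \<and>
        \<alpha> \<ge> 0 \<and> \<beta> \<ge> 0 \<and> \<gamma> \<ge> 0 \<and>
        \<alpha> * \<beta> - \<delta> * (\<delta> + u * \<eta>) = v * w * \<eta>\<^sup>2 \<and>
        \<beta> * \<gamma> - \<zeta> * (\<zeta> + u * \<iota>) = v * w * \<iota>\<^sup>2 \<and>
        \<alpha> * \<gamma> - \<epsilon> * (\<epsilon> + u * \<theta>) = v * w * \<theta>\<^sup>2 \<and>
        2 * \<alpha> * \<beta> * \<gamma> =
          \<delta> * (\<epsilon> + u * \<theta>) * \<zeta> + (\<delta> + u * \<eta>) * \<epsilon> * (\<zeta> + u * \<iota>)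
          + v * w * ((2 * \<delta> + u * \<eta>) * \<theta> * \<iota> - (2 * \<epsilon> + u * \<theta>) * \<eta> * \<iota>
                     + (2 * \<zeta> + u * \<iota>) * \<eta> * \<theta>)}"

end

theory Submission
  imports Defs
begin

text \<open>In coordinates with respect to a basis of \<open>\<Lambda>\<close>, the bivector \<open>\<lambda> \<and> w\<tau>\<lambda>\<close> has the fifteen coordinates
  \<open>\<alpha>, \<dots>, \<zeta>\<close>, \<open>\<delta> + u\<eta>\<close>, \<dots>, and \<open>v\<close> and \<open>w\<close> times \<open>\<eta>, \<theta>, \<iota>\<close> (up to sign, before division by \<open>r\<close>), so
  \<open>gcd(u, v, w) = 1\<close> makes its content the gcd of the nine forms. These forms are the entries of the
  rank one Hermitian matrix \<open>w \<lambda> \<lambda>\<^sup>*\<close>, written as \<open>H\<^sub>i\<^sub>j = x - w\<tau>y\<close> with integers \<open>x, y\<close>. The equations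
  say that a positive semidefinite Hermitian matrix has rank at most one, and a nonzero column of
  such a matrix is a vector \<open>\<lambda>\<close> that gives a positive multiple of the matrix.\<close>

subsection \<open>Abelian groups with integer coordinates\<close>

text \<open>An isomorphism of \<open>G\<close> with the group of all integer functions on
  \<open>I\<close>, given by its components. It turns multiples, contents and primitivity into
  divisibility of integers.\<close>

locale free_coordinates = comm_group G for G (structure) +
  fixes I :: "'i set" and X :: "'i \<Rightarrow> 'a \<Rightarrow> int"
  assumes coord_mult:
      "\<lbrakk>i \<in> I; x \<in> carrier G; y \<in> carrier G\<rbrakk> \<Longrightarrow> X i (x \<otimes> y) = X i x + X i y"
    and coord_surj: "\<exists>x\<in>carrier G. \<forall>i\<in>I. X i x = k i"
    and coord_inj:
      "\<lbrakk>x \<in> carrier G; y \<in> carrier G; \<And>i. i \<in> I \<Longrightarrow> X i x = X i y\<rbrakk> \<Longrightarrow> x = y"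
begin

lemma coord_one: "i \<in> I \<Longrightarrow> X i \<one> = 0"
  using coord_mult[of i \<one> \<one>] by simp

lemma coord_inv: "\<lbrakk>i \<in> I; x \<in> carrier G\<rbrakk> \<Longrightarrow> X i (inv x) = - X i x"
  using coord_mult[of i x "inv x"] coord_one by simp

lemma coord_nat_pow: "\<lbrakk>i \<in> I; x \<in> carrier G\<rbrakk> \<Longrightarrow> X i (x [^] (n::nat)) = int n * X i x"
  by (induction n) (simp_all add: coord_one coord_mult algebra_simps)

lemma coord_int_pow: "\<lbrakk>i \<in> I; x \<in> carrier G\<rbrakk> \<Longrightarrow> X i (x [^] (n::int)) = n * X i x"
  by (cases n rule: int_cases2)
    (simp_all add: int_pow_int int_pow_neg_int coord_inv coord_nat_pow)

lemma coord_eq_one_iff: "x \<in> carrier G \<Longrightarrow> x = \<one> \<longleftrightarrow> (\<forall>i\<in>I. X i x = 0)"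
  using coord_inj[of x \<one>] coord_one by auto

text \<open>Surjectivity of the coordinates produces an element whose coordinates are the quotients,
  and injectivity identifies its \<open>r\<close>-th multiple with \<open>x\<close>. For
  \<open>r = 0\<close> both sides say that \<open>x\<close> is neutral.\<close>

lemma multiple_iff_dvd:
  assumes "x \<in> carrier G"
  shows "(\<exists>y\<in>carrier G. x = y [^] (r::nat)) \<longleftrightarrow> (\<forall>i\<in>I. int r dvd X i x)"
proof
  assume "\<forall>i\<in>I. int r dvd X i x"
  moreover obtain y where y: "y \<in> carrier G" "\<forall>i\<in>I. X i y = X i x div int r"
    using coord_surj[of "\<lambda>i. X i x div int r"] by blast
  ultimately have "X i x = X i (y [^] r)" if "i \<in> I" for i
    using that by (simp add: coord_nat_pow)
  with assms y(1) have "x = y [^] r"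
    by (intro coord_inj) simp_all
  with y show "\<exists>y\<in>carrier G. x = y [^] r" by blast
next
  assume "\<exists>y\<in>carrier G. x = y [^] r"
  then show "\<forall>i\<in>I. int r dvd X i x" using coord_nat_pow by fastforce
qed

lemma integral_content_eq_Gcd:
  assumes "x \<in> carrier G" "x \<noteq> \<one>"
  shows "int (integral_content G x) = Gcd ((\<lambda>i. X i x) ` I)" (is "_ = ?g")
proof -
  have "?g > 0"
    using assms coord_eq_one_iff[of x] Gcd_0_iff[of "(\<lambda>i. X i x) ` I"] Gcd_int_greater_eq_0[of "(\<lambda>i. X i x) ` I"]
    by (auto simp: less_le)
  moreover have "integral_content G x = (GREATEST r. r > 0 \<and> int r dvd ?g)"
    by (simp add: integral_content_def multiple_iff_dvd[OF assms(1)] dvd_Gcd_iff)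
  ultimately have "integral_content G x = nat ?g"
    by (simp only:, intro Greatest_equality) (auto simp: le_nat_iff dest: zdvd_imp_le)
  with \<open>?g > 0\<close> show ?thesis by simp
qed

lemma dvd_integral_content_iff:
  assumes "x \<in> carrier G" "x \<noteq> \<one>"
  shows "k dvd int (integral_content G x) \<longleftrightarrow> (\<forall>i\<in>I. k dvd X i x)"
  by (simp add: integral_content_eq_Gcd[OF assms] dvd_Gcd_iff)

text \<open>The neutral element is treated separately because its content has no meaning: its
  coordinates have gcd 0, and it is not primitive by definition.\<close>

lemma primitive_iff_Gcd:
  assumes "x \<in> carrier G"
  shows "primitive G x \<longleftrightarrow> Gcd ((\<lambda>i. X i x) ` I) = 1"
proof (cases "x = \<one>")
  case True
  then have "Gcd ((\<lambda>i. X i x) ` I) = 0"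
    by (simp add: Gcd_0_iff image_subset_iff coord_one)
  with True show ?thesis by (simp add: primitive_def del: Gcd_0_iff)
next
  case False
  with integral_content_eq_Gcd[OF assms False] assms show ?thesis
    unfolding primitive_def by (metis of_nat_1 of_nat_eq_iff)
qed

text \<open>The content divides every coordinate, so a quotient exists. Cancelling
  \<open>r > 0\<close> in each coordinate makes it unique, so the definite description denotes
  it.\<close>

lemma exact_quotient_content:
  assumes "x \<in> carrier G" "x \<noteq> \<one>"
  defines "r \<equiv> integral_content G x" and "y \<equiv> exact_quotient G x (integral_content G x)"
  shows "r > 0" "y \<in> carrier G" "i \<in> I \<Longrightarrow> int r * X i y = X i x"
proof -
  have r: "\<forall>i\<in>I. int r dvd X i x"
    using dvd_integral_content_iff[OF assms(1,2), of "int r"] by (simp add: r_def)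
  show "r > 0"
    using r assms(1,2) coord_eq_one_iff[of x] by (cases "r = 0") auto
  obtain z where z: "z \<in> carrier G" "x = z [^] r"
    using r multiple_iff_dvd[OF assms(1)] by blast
  have "y = z"
    unfolding y_def exact_quotient_def r_def[symmetric]
  proof (rule the_equality)
    fix z' assume z': "z' \<in> carrier G \<and> z' [^] r = x"
    show "z' = z"
    proof (rule coord_inj)
      fix i assume "i \<in> I"
      then have "int r * X i z' = int r * X i z"
        using z z' by (metis coord_nat_pow)
      then show "X i z' = X i z" using \<open>r > 0\<close> by simp
    qed (use z z' in auto)
  qed (use z in auto)
  with z(1) show "y \<in> carrier G" by simp
  show "int r * X i y = X i x" if "i \<in> I"
    unfolding \<open>y = z\<close> z(2) using that z(1) by (simp only: coord_nat_pow)
qed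

end

subsection \<open>The exterior square\<close>

text \<open>The Z-linear extension of \<open>f\<close> to formal combinations. The free abelian
  group on the one-point type stands in for Z, so that \<open>frag_extend\<close> supplies
  linearity.\<close>

definition frag_eval :: "('a \<Rightarrow> int) \<Rightarrow> ('a \<Rightarrow>\<^sub>0 int) \<Rightarrow> int" where
  "frag_eval f z = Poly_Mapping.lookup (frag_extend (\<lambda>a. frag_cmul (f a) (frag_of ())) z) ()"

lemma frag_eval_0 [simp]: "frag_eval f 0 = 0"
  by (simp add: frag_eval_def)

lemma frag_eval_of [simp]: "frag_eval f (frag_of a) = f a"
  by (simp add: frag_eval_def)

lemma frag_eval_cmul [simp]: "frag_eval f (frag_cmul c z) = c * frag_eval f z"
  by (simp add: frag_eval_def frag_extend_cmul)

lemma frag_eval_add [simp]: "frag_eval f (z + z') = frag_eval f z + frag_eval f z'"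
  by (simp add: frag_eval_def frag_extend_add Poly_Mapping.lookup_add)

lemma frag_eval_minus [simp]: "frag_eval f (- z) = - frag_eval f z"
  using frag_eval_cmul[of f "-1" z] by simp

lemma frag_eval_diff [simp]: "frag_eval f (z - z') = frag_eval f z - frag_eval f z'"
  using frag_eval_add[of f z "- z'"] by simp

lemma frag_eval_sum [simp]: "frag_eval f (sum g A) = (\<Sum>a\<in>A. frag_eval f (g a))"
  by (induction A rule: infinite_finite_induct) simp_all

text \<open>The Pluecker coordinate with indices \<open>i\<close> and \<open>j\<close>, evaluated at
  an arbitrary representative of the coset. The value does not depend on the representative because
  the minors vanish on the wedge kernel.\<close>

definition wedge_coord :: "('i \<Rightarrow> 'a \<Rightarrow> int) \<Rightarrow> 'i \<times> 'i \<Rightarrow> ('a \<times> 'a \<Rightarrow>\<^sub>0 int) set \<Rightarrow> int" where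
  "wedge_coord X = (\<lambda>(i, j) S.
     frag_eval (\<lambda>(x, y). X i x * X j y - X j x * X i y) (SOME z. z \<in> S))"

section \<open>Computing modulo the wedge relations\<close>

context comm_group
begin

abbreviation "W \<equiv> free_Abelian_group (carrier G \<times> carrier G)"
abbreviation "K \<equiv> wedge_kernel G"

lemma wedge_relations_subset: "wedge_relations G \<subseteq> carrier W"
  unfolding wedge_relations_def
  by (auto dest!: subsetD[OF keys_diff] simp: keys_frag_of)

lemma subgroup_wedge_kernel: "subgroup K W"
  unfolding wedge_kernel_def
  by (rule group.generate_is_subgroup[OF group_free_Abelian_group wedge_relations_subset])

lemma normal_wedge_kernel: "K \<lhd> W"
  by (simp add: comm_group.normal_iff_subgroup[OF abelian_free_Abelian_group] subgroup_wedge_kernel)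

lemma wedge_kernel_0 [simp]: "0 \<in> K"
  using subgroup.one_closed[OF subgroup_wedge_kernel] by simp

lemma wedge_kernel_add: "\<lbrakk>z \<in> K; z' \<in> K\<rbrakk> \<Longrightarrow> z + z' \<in> K"
  using subgroup.m_closed[OF subgroup_wedge_kernel] by simp

lemma wedge_kernel_keys: "z \<in> K \<Longrightarrow> Poly_Mapping.keys z \<subseteq> carrier G \<times> carrier G"
  using subgroup.mem_carrier[OF subgroup_wedge_kernel] by simp

lemma wedge_kernel_minus: "z \<in> K \<Longrightarrow> - z \<in> K"
  using subgroup.m_inv_closed[OF subgroup_wedge_kernel] wedge_kernel_keys by force

lemma wedge_kernel_diff: "\<lbrakk>z \<in> K; z' \<in> K\<rbrakk> \<Longrightarrow> z - z' \<in> K"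
  using wedge_kernel_add[of z "- z'"] wedge_kernel_minus by simp

lemma wedge_kernel_cmul: "z \<in> K \<Longrightarrow> frag_cmul c z \<in> K"
  by (rule frag_closure_minus_cmul) (auto intro: wedge_kernel_diff)

lemma wedge_kernel_sum: "(\<And>i. i \<in> A \<Longrightarrow> f i \<in> K) \<Longrightarrow> sum f A \<in> K"
  by (induction A rule: infinite_finite_induct) (auto intro: wedge_kernel_add)

lemma wedge_kernel_left:
  "\<lbrakk>x \<in> carrier G; y \<in> carrier G; z \<in> carrier G\<rbrakk> \<Longrightarrow>
     frag_of (x \<otimes> y, z) - frag_of (x, z) - frag_of (y, z) \<in> K"
  unfolding wedge_kernel_def wedge_relations_def by (rule generate.incl) blast

lemma wedge_kernel_right:
  "\<lbrakk>x \<in> carrier G; y \<in> carrier G; z \<in> carrier G\<rbrakk> \<Longrightarrow>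
     frag_of (z, x \<otimes> y) - frag_of (z, x) - frag_of (z, y) \<in> K"
  unfolding wedge_kernel_def wedge_relations_def by (rule generate.incl) blast

lemma wedge_kernel_diag: "x \<in> carrier G \<Longrightarrow> frag_of (x, x) \<in> K"
  unfolding wedge_kernel_def wedge_relations_def by (rule generate.incl) blast

text \<open>Polarisation: the diagonal relation for \<open>x \<otimes> y\<close> is expanded by
  biadditivity, and the diagonal terms of \<open>x\<close> and \<open>y\<close> are removed.\<close>

lemma wedge_kernel_swap:
  assumes "x \<in> carrier G" "y \<in> carrier G"
  shows "frag_of (x, y) + frag_of (y, x) \<in> K"
proof -
  let ?s = "x \<otimes> y"
  have s: "?s \<in> carrier G" using assms by simp
  note * = wedge_kernel_diag[OF s] wedge_kernel_left[OF assms s]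
    wedge_kernel_right[OF assms assms(1)] wedge_kernel_right[OF assms assms(2)]
    wedge_kernel_diag[OF assms(1)] wedge_kernel_diag[OF assms(2)]
  from wedge_kernel_diff[OF wedge_kernel_diff[OF wedge_kernel_diff[OF wedge_kernel_diff[OF
          wedge_kernel_diff[OF *(1,2)] *(3)] *(4)] *(5)] *(6)]
  show ?thesis by (simp add: algebra_simps)
qed

lemma wedge_coset_eq_iff:
  assumes "z \<in> carrier W" "z' \<in> carrier W"
  shows "K #>\<^bsub>W\<^esub> z = K #>\<^bsub>W\<^esub> z' \<longleftrightarrow> z - z' \<in> K"
proof -
  have "K #>\<^bsub>W\<^esub> z = K #>\<^bsub>W\<^esub> z' \<longleftrightarrow> z \<in> K #>\<^bsub>W\<^esub> z'"
    using assms subgroup_wedge_kernel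
    by (metis group.repr_independence group.rcos_self group_free_Abelian_group)
  also have "\<dots> \<longleftrightarrow> z - z' \<in> K"
    using subgroup.rcos_module[OF subgroup_wedge_kernel group_free_Abelian_group assms(2,1)] assms
    by simp
  finally show ?thesis .
qed

lemma comm_group_exterior_square: "comm_group (exterior_square G)"
  unfolding exterior_square_def
  by (rule comm_group.abelian_FactGroup[OF abelian_free_Abelian_group subgroup_wedge_kernel])

lemma carrier_exterior_square: "carrier (exterior_square G) = (\<lambda>z. K #>\<^bsub>W\<^esub> z) ` carrier W"
  unfolding exterior_square_def by (rule carrier_FactGroup)

lemma mult_exterior_square:
  assumes "z \<in> carrier W" "z' \<in> carrier W"
  shows "(K #>\<^bsub>W\<^esub> z) \<otimes>\<^bsub>exterior_square G\<^esub> (K #>\<^bsub>W\<^esub> z') = K #>\<^bsub>W\<^esub> (z + z')"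
  unfolding exterior_square_def
  using normal.rcos_sum[OF normal_wedge_kernel assms] by simp

lemma wedge_in_carrier:
  "\<lbrakk>x \<in> carrier G; y \<in> carrier G\<rbrakk> \<Longrightarrow> wedge G x y \<in> carrier (exterior_square G)"
  by (auto simp: wedge_def carrier_exterior_square)

text \<open>A map that is additive modulo \<open>K\<close> respects integer multiples modulo
  \<open>K\<close>. Keeping \<open>\<phi>\<close> general serves both arguments of the wedge: it
  will be \<open>frag_of\<close> with one component of the pair fixed.\<close>

lemma additive_mod_wedge_kernel_int_pow:
  assumes \<phi>: "\<And>x y. \<lbrakk>x \<in> carrier G; y \<in> carrier G\<rbrakk> \<Longrightarrow> \<phi> (x \<otimes> y) - \<phi> x - \<phi> y \<in> K"
    and b: "b \<in> carrier G"
  shows "\<phi> (b [^] (k::int)) - frag_cmul k (\<phi> b) \<in> K"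
proof (induction k rule: int_induct[where k = 0])
  case base
  \<comment> \<open>Additivity at the neutral element leaves \<open>- \<phi> \<one>\<close>, hence
    \<open>\<phi> \<one> \<in> K\<close>.\<close>
  have "- (\<phi> (\<one> \<otimes> \<one>) - \<phi> \<one> - \<phi> \<one>) \<in> K"
    by (intro wedge_kernel_minus \<phi>) auto
  then show ?case by simp
next
  case (step1 k)
  have "\<phi> (b [^] k \<otimes> b) - \<phi> (b [^] k) - \<phi> b + (\<phi> (b [^] k) - frag_cmul k (\<phi> b)) \<in> K"
    using step1 b by (intro wedge_kernel_add \<phi>) auto
  moreover have "b [^] (k + 1) = b [^] k \<otimes> b"
    using int_pow_mult[OF b, of k 1] b by simp
  ultimately show ?case
    by (simp add: frag_cmul_distrib algebra_simps)
next
  case (step2 k)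
  have "b [^] k = b [^] (k - 1) \<otimes> b"
    using int_pow_mult[OF b, of "k - 1" 1] b by simp
  then have "\<phi> (b [^] k) - \<phi> (b [^] (k - 1)) - \<phi> b \<in> K"
    using \<phi>[of "b [^] (k - 1)" b] b by simp
  from wedge_kernel_diff[OF step2.IH this] show ?case
    by (simp add: frag_cmul_diff_distrib algebra_simps)
qed

end

section \<open>Minors as coordinates on the exterior square\<close>

locale finite_free_coordinates = free_coordinates G "{..<n::nat}" X for G (structure) and n X
begin

text \<open>The basis dual to the coordinates. For \<open>j \<ge> n\<close> it yields the neutral
  element, so membership in the carrier holds for every \<open>j\<close>.\<close>

definition basis :: "nat \<Rightarrow> 'a" where
  "basis j = (SOME x. x \<in> carrier G \<and> (\<forall>i<n. X i x = (if i = j then 1 else 0)))"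

lemma basis: "basis j \<in> carrier G" "i < n \<Longrightarrow> X i (basis j) = (if i = j then 1 else 0)"
proof -
  have "\<exists>x. x \<in> carrier G \<and> (\<forall>i<n. X i x = (if i = j then 1 else 0))"
    using coord_surj[of "\<lambda>i. if i = j then 1 else 0"] by auto
  from someI_ex[OF this] show "basis j \<in> carrier G"
    "i < n \<Longrightarrow> X i (basis j) = (if i = j then 1 else 0)"
    by (auto simp: basis_def)
qed

text \<open>One basis component is split off at a time, by induction on the number \<open>m\<close>
  of leading coordinates that may be nonzero.\<close>

lemma additive_mod_wedge_kernel_expand:
  assumes \<phi>: "\<And>x y. \<lbrakk>x \<in> carrier G; y \<in> carrier G\<rbrakk> \<Longrightarrow> \<phi> (x \<otimes> y) - \<phi> x - \<phi> y \<in> K"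
    and "x \<in> carrier G"
  shows "\<phi> x - (\<Sum>i<n. frag_cmul (X i x) (\<phi> (basis i))) \<in> K"
proof -
  have "\<phi> x - (\<Sum>i<m. frag_cmul (X i x) (\<phi> (basis i))) \<in> K"
    if "m \<le> n" "x \<in> carrier G" "\<And>i. \<lbrakk>m \<le> i; i < n\<rbrakk> \<Longrightarrow> X i x = 0" for m x
    using that
  proof (induction m arbitrary: x)
    case 0
    then have "x = basis 0 [^] (0::int)"
      by (simp add: coord_eq_one_iff)
    then show ?case
      using additive_mod_wedge_kernel_int_pow[of \<phi> "basis 0" 0, OF \<phi> basis(1)] by simp
  next
    case (Suc m)
    \<comment> \<open>\<open>p\<close> is the component of \<open>x\<close> along
      \<open>basis m\<close>. The rest \<open>y\<close> has zero coordinates from index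
      \<open>m\<close> on, so the induction hypothesis applies to it.\<close>
    define p where "p = basis m [^] X m x"
    define y where "y = x \<otimes> inv p"
    have p: "p \<in> carrier G" and y: "y \<in> carrier G"
      using Suc.prems basis by (auto simp: p_def y_def)
    have Xp: "X i p = (if i = m then X m x else 0)" if "i < n" for i
      using that basis by (simp add: p_def coord_int_pow)
    have Xy: "X i y = (if i = m then 0 else X i x)" if "i < n" for i
      using that Suc.prems p Xp by (simp add: y_def coord_mult coord_inv)
    have x: "x = y \<otimes> p"
      using Suc.prems p by (simp add: y_def m_assoc)
    have "X i y = 0" if "m \<le> i" "i < n" for i
      using Xy[of i] Suc.prems(3)[of i] that by (cases "i = m") auto
    then have "\<phi> y - (\<Sum>i<m. frag_cmul (X i y) (\<phi> (basis i))) \<in> K"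
      using Suc.prems(1) y by (intro Suc.IH) auto
    moreover have "(\<Sum>i<m. frag_cmul (X i y) (\<phi> (basis i))) = (\<Sum>i<m. frag_cmul (X i x) (\<phi> (basis i)))"
      using Xy Suc.prems by (intro sum.cong) auto
    moreover have "\<phi> p - frag_cmul (X m x) (\<phi> (basis m)) \<in> K"
      unfolding p_def by (rule additive_mod_wedge_kernel_int_pow[of \<phi>, OF \<phi> basis(1)])
    moreover have "\<phi> x - \<phi> y - \<phi> p \<in> K"
      using \<phi>[OF y p] x by simp
    ultimately have "\<phi> x - \<phi> y - \<phi> p + (\<phi> p - frag_cmul (X m x) (\<phi> (basis m)))
       + (\<phi> y - (\<Sum>i<m. frag_cmul (X i x) (\<phi> (basis i)))) \<in> K"
      by (intro wedge_kernel_add) auto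
    then show ?case by (simp add: algebra_simps)
  qed
  from this[of n] assms(2) show ?thesis by simp
qed

text \<open>The first argument is expanded in the basis, then the second argument within each
  term.\<close>

lemma frag_of_mod_wedge_kernel_expand:
  assumes "x \<in> carrier G" "y \<in> carrier G"
  shows "frag_of (x, y) - (\<Sum>i<n. \<Sum>j<n. frag_cmul (X i x * X j y) (frag_of (basis i, basis j))) \<in> K"
proof -
  have "frag_of (x, y) - (\<Sum>i<n. frag_cmul (X i x) (frag_of (basis i, y))) \<in> K"
    using assms by (intro additive_mod_wedge_kernel_expand[of "\<lambda>x. frag_of (x, y)"] wedge_kernel_left)
  moreover have "(\<Sum>i<n. frag_cmul (X i x) (frag_of (basis i, y)
      - (\<Sum>j<n. frag_cmul (X j y) (frag_of (basis i, basis j))))) \<in> K"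
    using assms basis(1)
    by (intro wedge_kernel_sum wedge_kernel_cmul
        additive_mod_wedge_kernel_expand[of "\<lambda>y. frag_of (basis _, y)"] wedge_kernel_right)
  ultimately have "frag_of (x, y) - (\<Sum>i<n. frag_cmul (X i x) (frag_of (basis i, y)))
      + (\<Sum>i<n. frag_cmul (X i x) (frag_of (basis i, y)
      - (\<Sum>j<n. frag_cmul (X j y) (frag_of (basis i, basis j))))) \<in> K"
    by (rule wedge_kernel_add)
  moreover have "frag_cmul c (a - b) = frag_cmul c a - frag_cmul c b" for c and a b :: "'a \<times> 'a \<Rightarrow>\<^sub>0 int"
    using frag_cmul_distrib2[of c "a - b" b] by (simp add: algebra_simps)
  ultimately show ?thesis
    by (simp add: sum_subtractf frag_cmul_sum algebra_simps)
qed

lemma mod_wedge_kernel_expand: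
  assumes "z \<in> carrier W"
  shows "z - (\<Sum>i<n. \<Sum>j<n. frag_cmul (frag_eval (\<lambda>(x, y). X i x * X j y) z)
            (frag_of (basis i, basis j))) \<in> K" (is "z - ?E z \<in> K")
proof -
  have "Poly_Mapping.keys z \<subseteq> carrier G \<times> carrier G" using assms by simp
  then show ?thesis
  proof (induction z rule: frag_induction)
    case (one p)
    then show ?case by (auto intro: frag_of_mod_wedge_kernel_expand)
  next
    case (diff a b)
    then have "(a - ?E a) - (b - ?E b) \<in> K" by (rule wedge_kernel_diff)
    then show ?case by (simp add: frag_cmul_diff_distrib sum_subtractf algebra_simps)
  qed simp
qed

text \<open>Off the diagonal the terms pair up to multiples of
  \<open>frag_of (basis i, basis j) + frag_of (basis j, basis i)\<close>, which lie in
  \<open>K\<close>, as do the diagonal terms. The induction adds one row and one column.\<close>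

lemma symmetric_sum_in_wedge_kernel:
  assumes "\<And>i j. \<lbrakk>i < n; j < n\<rbrakk> \<Longrightarrow> M i j = M j i"
  shows "(\<Sum>i<n. \<Sum>j<n. frag_cmul (M i j) (frag_of (basis i, basis j))) \<in> K"
proof -
  have "(\<Sum>i<m. \<Sum>j<m. frag_cmul (M i j) (frag_of (basis i, basis j))) \<in> K" if "m \<le> n" for m
    using that
  proof (induction m)
    case (Suc m)
    have "(\<Sum>i<m. \<Sum>j<m. frag_cmul (M i j) (frag_of (basis i, basis j)))
      + (\<Sum>i<m. frag_cmul (M i m) (frag_of (basis i, basis m) + frag_of (basis m, basis i)))
      + frag_cmul (M m m) (frag_of (basis m, basis m)) \<in> K"
      using Suc
      by (auto intro!: wedge_kernel_add[OF wedge_kernel_add] wedge_kernel_sum wedge_kernel_cmul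
          wedge_kernel_swap wedge_kernel_diag basis(1) simp del: minus_frag_cmul)
    moreover have "(\<Sum>j<m. frag_cmul (M m j) (frag_of (basis m, basis j)))
        = (\<Sum>i<m. frag_cmul (M i m) (frag_of (basis m, basis i)))"
      using Suc.prems by (intro sum.cong refl) (simp add: assms)
    ultimately show ?case
      by (simp add: sum.distrib frag_cmul_distrib2 algebra_simps)
  qed simp
  then show ?thesis by simp
qed

abbreviation "minor i j \<equiv> frag_eval (\<lambda>(x, y). X i x * X j y - X j x * X i y)"

lemma minor_eq:
  "minor i j z = frag_eval (\<lambda>(x, y). X i x * X j y) z - frag_eval (\<lambda>(x, y). X j x * X i y) z"
proof -
  have "Poly_Mapping.keys z \<subseteq> UNIV" by simp
  then show ?thesis
    by (induction z rule: frag_induction) auto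
qed

text \<open>A minor is biadditive and alternating in its two arguments, so it kills every generator
  of \<open>K\<close> and, being linear, all of \<open>K\<close>.\<close>

lemma minor_wedge_kernel:
  assumes "i < n" "j < n" "z \<in> K"
  shows "minor i j z = 0"
proof -
  have rel: "minor i j h = 0" if "h \<in> wedge_relations G" for h
    using that assms(1,2) unfolding wedge_relations_def
    by (elim UnE CollectE exE conjE)
      (simp_all only: frag_eval_diff frag_eval_of case_prod_conv,
       simp_all add: coord_mult algebra_simps)
  show ?thesis
    using assms(3) unfolding wedge_kernel_def
  proof (induction rule: generate.induct)
    case (inv h)
    have "Poly_Mapping.keys h \<subseteq> carrier G \<times> carrier G"
      using subsetD[OF wedge_relations_subset inv] by simp
    then show ?case by (simp add: rel[OF inv])
  qed (simp_all add: rel)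
qed

text \<open>If the minors vanish, the coefficient matrix of \<open>z\<close> in the basis pairs is
  symmetric, so the expansion of \<open>z\<close> lies in \<open>K\<close>. Hence the minors
  separate the classes modulo \<open>K\<close>.\<close>

lemma wedge_kernel_iff:
  assumes "z \<in> carrier W"
  shows "z \<in> K \<longleftrightarrow> (\<forall>i j. i < j \<and> j < n \<longrightarrow> minor i j z = 0)"
proof
  assume z: "\<forall>i j. i < j \<and> j < n \<longrightarrow> minor i j z = 0"
  let ?M = "\<lambda>i j. frag_eval (\<lambda>(x, y). X i x * X j y) z"
  have "?M i j = ?M j i" if "i < n" "j < n" for i j
    using z that minor_eq[of i j z] minor_eq[of j i z] by (cases i j rule: linorder_cases) auto
  then have "(\<Sum>i<n. \<Sum>j<n. frag_cmul (?M i j) (frag_of (basis i, basis j))) \<in> K"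
    by (intro symmetric_sum_in_wedge_kernel)
  from wedge_kernel_add[OF mod_wedge_kernel_expand[OF assms] this] show "z \<in> K" by simp
qed (auto intro: minor_wedge_kernel)

lemma wedge_coord_coset:
  assumes "i < n" "j < n" "z \<in> carrier W"
  shows "wedge_coord X (i, j) (K #>\<^bsub>W\<^esub> z) = minor i j z"
proof -
  have "(SOME z'. z' \<in> K #>\<^bsub>W\<^esub> z) \<in> K #>\<^bsub>W\<^esub> z"
    using group.rcos_self[OF group_free_Abelian_group assms(3) subgroup_wedge_kernel] by (rule someI)
  then have "(SOME z'. z' \<in> K #>\<^bsub>W\<^esub> z) - z \<in> K"
    using subgroup.rcos_module_imp[OF subgroup_wedge_kernel group_free_Abelian_group assms(3)] assms(3)
    by fastforce
  from minor_wedge_kernel[OF assms(1,2) this] show ?thesis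
    by (simp add: wedge_coord_def)
qed

lemma wedge_coord_wedge:
  assumes "i < n" "j < n" "x \<in> carrier G" "y \<in> carrier G"
  shows "wedge_coord X (i, j) (wedge G x y) = X i x * X j y - X j x * X i y"
  using wedge_coord_coset[of i j "frag_of (x, y)"] assms by (simp add: wedge_def)

text \<open>The wedges of two basis elements with \<open>i < j\<close> form a basis. Combinations of
  them attain all coordinates, and \<open>wedge_kernel_iff\<close> gives injectivity.\<close>

lemma free_coordinates_exterior_square:
  "free_coordinates (exterior_square G) {(i, j). i < j \<and> j < n} (wedge_coord X)"
proof -
  interpret E: comm_group "exterior_square G" by (rule comm_group_exterior_square)
  show ?thesis
  proof unfold_locales
    fix p S T
    assume "p \<in> {(i, j). i < j \<and> j < n}"
      and S: "S \<in> carrier (exterior_square G)" and T: "T \<in> carrier (exterior_square G)"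
    then obtain i j where p: "p = (i, j)" "i < n" "j < n" by auto
    obtain z where z: "z \<in> carrier W" "S = K #>\<^bsub>W\<^esub> z"
      using S carrier_exterior_square by blast
    obtain z' where z': "z' \<in> carrier W" "T = K #>\<^bsub>W\<^esub> z'"
      using T carrier_exterior_square by blast
    have "z + z' \<in> carrier W"
      using z z' keys_add[of z z'] by auto
    then show "wedge_coord X p (S \<otimes>\<^bsub>exterior_square G\<^esub> T) = wedge_coord X p S + wedge_coord X p T"
      using p z z' by (simp add: mult_exterior_square wedge_coord_coset del: carrier_free_Abelian_group_iff)
  next
    fix k :: "nat \<times> nat \<Rightarrow> int"
    define z where "z = (\<Sum>j<n. \<Sum>i<j. frag_cmul (k (i, j)) (frag_of (basis i, basis j)))"
    have z: "z \<in> carrier W"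
      unfolding z_def using basis(1)
      by (intro sum_closed_free_Abelian_group) (auto simp: keys_frag_of dest!: subsetD[OF keys_cmul])
    have "minor a b z = k (a, b)" if "a < b" "b < n" for a b
    proof -
      have "minor a b z = (\<Sum>j<n. \<Sum>i<j. k (i, j) * (X a (basis i) * X b (basis j) - X b (basis i) * X a (basis j)))"
        by (simp add: z_def)
      \<comment> \<open>The negative product would need \<open>i = b\<close> and
        \<open>j = a\<close>, against \<open>i < j\<close> and \<open>a < b\<close>.\<close>
      also have "\<dots> = (\<Sum>j<n. \<Sum>i<j. if j = b then if i = a then k (i, j) else 0 else 0)"
        using that by (intro sum.cong refl) (auto simp: basis(2))
      also have "\<dots> = (\<Sum>j<n. if j = b then (\<Sum>i<j. if i = a then k (i, j) else 0) else 0)"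
        by (intro sum.cong refl) simp
      also have "\<dots> = k (a, b)"
        using that by simp
      finally show ?thesis .
    qed
    with z show "\<exists>S\<in>carrier (exterior_square G). \<forall>p\<in>{(i, j). i < j \<and> j < n}. wedge_coord X p S = k p"
      by (intro bexI[of _ "K #>\<^bsub>W\<^esub> z"]) (auto simp: wedge_coord_coset carrier_exterior_square simp del: carrier_free_Abelian_group_iff)
  next
    fix S T
    assume S: "S \<in> carrier (exterior_square G)" and T: "T \<in> carrier (exterior_square G)"
      and eq: "\<And>p. p \<in> {(i, j). i < j \<and> j < n} \<Longrightarrow> wedge_coord X p S = wedge_coord X p T"
    obtain z where z: "z \<in> carrier W" "S = K #>\<^bsub>W\<^esub> z"
      using S carrier_exterior_square by blast
    obtain z' where z': "z' \<in> carrier W" "T = K #>\<^bsub>W\<^esub> z'"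
      using T carrier_exterior_square by blast
    have "minor i j z = minor i j z'" if "i < j" "j < n" for i j
      using eq[of "(i, j)"] that z z' wedge_coord_coset[of i j] by simp
    moreover have "z - z' \<in> carrier W"
      using z z' keys_diff[of z z'] by auto
    ultimately have "z - z' \<in> K" by (simp add: wedge_kernel_iff)
    then show "S = T" using z z' wedge_coset_eq_iff by simp
  qed
qed

end

subsection \<open>The norm form and rank one Hermitian matrices\<close>

text \<open>For \<open>p = v * w\<close> the form is the norm of \<open>x - w\<tau>y\<close>. It is
  positive definite, since four times it is a sum of two nonnegative terms.\<close>

lemma norm_form_eq_0:
  fixes x y u p :: int
  assumes "u\<^sup>2 - 4 * p < 0" "x\<^sup>2 + u * x * y + p * y\<^sup>2 = 0"
  shows "x = 0" "y = 0"
proof -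
  have *: "(2 * x + u * y)\<^sup>2 + (4 * p - u\<^sup>2) * y\<^sup>2 = 0"
    using assms(2) by algebra
  have "(4 * p - u\<^sup>2) * y\<^sup>2 \<ge> 0" using assms(1) by simp
  with * have "(4 * p - u\<^sup>2) * y\<^sup>2 = 0" "(2 * x + u * y)\<^sup>2 = 0"
    by (smt (verit) zero_le_power2)+
  then show "y = 0" "x = 0" using assms(1) by auto
qed

lemma int9_cases:
  fixes V :: int9
  obtains \<alpha> \<beta> \<gamma> \<delta> \<epsilon> \<zeta> \<eta> \<theta> \<iota> where "V = (\<alpha>, \<beta>, \<gamma>, \<delta>, \<epsilon>, \<zeta>, \<eta>, \<theta>, \<iota>)"
  by (cases V) auto

text \<open>The entries of \<open>w \<lambda> \<lambda>\<^sup>*\<close> on and above the diagonal.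
  An off-diagonal entry \<open>x - w\<tau>y\<close> contributes \<open>x\<close> to the fourth to
  sixth components and \<open>y\<close> to the last three.\<close>

fun forms :: "int \<Rightarrow> int \<Rightarrow> int \<Rightarrow> int \<Rightarrow> int \<Rightarrow> int \<Rightarrow> int \<Rightarrow> int \<Rightarrow> int \<Rightarrow> int9" where
  "forms u v w a b c d e f =
    (w * a\<^sup>2 - u * a * d + v * d\<^sup>2, w * b\<^sup>2 - u * b * e + v * e\<^sup>2, w * c\<^sup>2 - u * c * f + v * f\<^sup>2,
     w * a * b - u * a * e + v * d * e, w * a * c - u * a * f + v * d * f,
     w * b * c - u * b * f + v * e * f, a * e - b * d, a * f - c * d, b * f - c * e)"

fun scale9 :: "int \<Rightarrow> int9 \<Rightarrow> int9" where
  "scale9 k (\<alpha>, \<beta>, \<gamma>, \<delta>, \<epsilon>, \<zeta>, \<eta>, \<theta>, \<iota>) =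
    (k * \<alpha>, k * \<beta>, k * \<gamma>, k * \<delta>, k * \<epsilon>, k * \<zeta>, k * \<eta>, k * \<theta>, k * \<iota>)"

fun entries9 :: "int9 \<Rightarrow> int set" where
  "entries9 (\<alpha>, \<beta>, \<gamma>, \<delta>, \<epsilon>, \<zeta>, \<eta>, \<theta>, \<iota>) = {\<alpha>, \<beta>, \<gamma>, \<delta>, \<epsilon>, \<zeta>, \<eta>, \<theta>, \<iota>}"

text \<open>With \<open>x - w\<tau>y\<close> encoded as \<open>(x, y)\<close>, these are the equations of a positive semidefinite
  Hermitian matrix \<open>H\<close> of rank at most one: \<open>|H\<^sub>i\<^sub>j|\<^sup>2 = H\<^sub>i\<^sub>i H\<^sub>j\<^sub>j\<close> and
  \<open>Re (H\<^sub>1\<^sub>2 H\<^sub>2\<^sub>3 H\<^sub>3\<^sub>1) = H\<^sub>1\<^sub>1 H\<^sub>2\<^sub>2 H\<^sub>3\<^sub>3\<close>.\<close>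

fun rank_one_eqs :: "int \<Rightarrow> int \<Rightarrow> int \<Rightarrow> int9 \<Rightarrow> bool" where
  "rank_one_eqs u v w (\<alpha>, \<beta>, \<gamma>, \<delta>, \<epsilon>, \<zeta>, \<eta>, \<theta>, \<iota>) \<longleftrightarrow>
    \<alpha> \<ge> 0 \<and> \<beta> \<ge> 0 \<and> \<gamma> \<ge> 0 \<and>
    \<alpha> * \<beta> - \<delta> * (\<delta> + u * \<eta>) = v * w * \<eta>\<^sup>2 \<and>
    \<beta> * \<gamma> - \<zeta> * (\<zeta> + u * \<iota>) = v * w * \<iota>\<^sup>2 \<and>
    \<alpha> * \<gamma> - \<epsilon> * (\<epsilon> + u * \<theta>) = v * w * \<theta>\<^sup>2 \<and>
    2 * \<alpha> * \<beta> * \<gamma> =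
      \<delta> * (\<epsilon> + u * \<theta>) * \<zeta> + (\<delta> + u * \<eta>) * \<epsilon> * (\<zeta> + u * \<iota>)
      + v * w * ((2 * \<delta> + u * \<eta>) * \<theta> * \<iota> - (2 * \<epsilon> + u * \<theta>) * \<eta> * \<iota>
                 + (2 * \<zeta> + u * \<iota>) * \<eta> * \<theta>)"

lemma parameter_vectors_eq:
  "parameter_vectors u v w = {V. primitive (additive_group UNIV) V \<and> rank_one_eqs u v w V}"
  by (auto simp: parameter_vectors_def)

text \<open>The form is \<open>w |a + \<tau>d|\<^sup>2\<close>; completing the square shows its sign
  over the integers.\<close>

lemma form_nonneg:
  fixes u v w a d :: int
  assumes "w > 0" "u\<^sup>2 - 4 * v * w < 0"
  shows "w * a\<^sup>2 - u * a * d + v * d\<^sup>2 \<ge> 0"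
proof -
  have "4 * w * (w * a\<^sup>2 - u * a * d + v * d\<^sup>2) = (2 * w * a - u * d)\<^sup>2 + (4 * v * w - u\<^sup>2) * d\<^sup>2"
    by algebra
  also have "\<dots> \<ge> 0" using assms(2) by (intro add_nonneg_nonneg mult_nonneg_nonneg) auto
  finally show ?thesis using assms(1) by (simp add: zero_le_mult_iff)
qed

lemma form_eq_0:
  fixes u v w a d :: int
  assumes "w > 0" "u\<^sup>2 - 4 * v * w < 0" "w * a\<^sup>2 - u * a * d + v * d\<^sup>2 = 0"
  shows "a = 0" "d = 0"
proof -
  \<comment> \<open>\<open>w\<close> times the form is the norm form at
    \<open>(w * a, - d)\<close>.\<close>
  have "(w * a)\<^sup>2 + u * (w * a) * (- d) + (v * w) * (- d)\<^sup>2 = 0"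
    using assms(3) by algebra
  from norm_form_eq_0[OF _ this] assms(1,2) show "a = 0" "d = 0"
    by (auto simp: mult.assoc)
qed

lemma forms_eq_0:
  assumes "w > 0" "u\<^sup>2 - 4 * v * w < 0" "forms u v w a b c d e f = (0, 0, 0, 0, 0, 0, 0, 0, 0)"
  shows "a = 0 \<and> b = 0 \<and> c = 0 \<and> d = 0 \<and> e = 0 \<and> f = 0"
  using form_eq_0[OF assms(1,2), of a d] form_eq_0[OF assms(1,2), of b e]
    form_eq_0[OF assms(1,2), of c f] assms(3) by auto

lemma forms_scale: "forms u v w (k * a) (k * b) (k * c) (k * d) (k * e) (k * f)
  = scale9 (k\<^sup>2) (forms u v w a b c d e f)"
  by (simp add: power2_eq_square algebra_simps)

text \<open>The signs come from definiteness; the equations are polynomial identities in the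
  coordinates of \<lambda>.\<close>

lemma rank_one_eqs_forms:
  assumes "w > 0" "u\<^sup>2 - 4 * v * w < 0"
  shows "rank_one_eqs u v w (forms u v w a b c d e f)"
  unfolding forms.simps rank_one_eqs.simps
  by (intro conjI form_nonneg[OF assms]; algebra)

text \<open>The equations are homogeneous of degree 2 or 3, so a power of \<open>r\<close>
  cancels.\<close>

lemma rank_one_eqs_scaleD:
  assumes "rank_one_eqs u v w (scale9 r V)" "r > 0"
  shows "rank_one_eqs u v w V"
proof -
  obtain \<alpha> \<beta> \<gamma> \<delta> \<epsilon> \<zeta> \<eta> \<theta> \<iota> where V: "V = (\<alpha>, \<beta>, \<gamma>, \<delta>, \<epsilon>, \<zeta>, \<eta>, \<theta>, \<iota>)"
    by (cases V) auto
  have cancel2: "x = y" if "r\<^sup>2 * x = r\<^sup>2 * y" for x y using that assms(2) by simp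
  have cancel3: "x = y" if "r ^ 3 * x = r ^ 3 * y" for x y using that assms(2) by simp
  show ?thesis
    using assms unfolding V scale9.simps rank_one_eqs.simps
    apply (elim conjE, intro conjI)
          apply (simp_all add: zero_le_mult_iff)[3]
       apply (rule cancel2, algebra)
      apply (rule cancel2, algebra)
     apply (rule cancel2, algebra)
    apply (rule cancel3, algebra)
    done
qed

text \<open>If \<open>H\<close> has rank one, column \<open>j\<close> times its conjugate transpose
  is \<open>H\<^sub>j\<^sub>j H\<close>. So the column through the first positive diagonal entry
  serves as \<lambda>, with \<open>s = w H\<^sub>j\<^sub>j\<close>.\<close>

lemma rank_one_vector:
  assumes "rank_one_eqs u v w V" "w > 0" "u\<^sup>2 - 4 * v * w < 0" "V \<noteq> (0, 0, 0, 0, 0, 0, 0, 0, 0)"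
  shows "\<exists>a b c d e f s. s > 0 \<and> forms u v w a b c d e f = scale9 s V"
proof -
  obtain \<alpha> \<beta> \<gamma> \<delta> \<epsilon> \<zeta> \<eta> \<theta> \<iota> where V: "V = (\<alpha>, \<beta>, \<gamma>, \<delta>, \<epsilon>, \<zeta>, \<eta>, \<theta>, \<iota>)"
    by (rule int9_cases)
  note eqs = assms(1)[unfolded V rank_one_eqs.simps]
  then have eq1: "\<alpha> * \<beta> - \<delta> * (\<delta> + u * \<eta>) = v * w * \<eta>\<^sup>2"
    and eq2: "\<beta> * \<gamma> - \<zeta> * (\<zeta> + u * \<iota>) = v * w * \<iota>\<^sup>2"
    and eq3: "\<alpha> * \<gamma> - \<epsilon> * (\<epsilon> + u * \<theta>) = v * w * \<theta>\<^sup>2" by blast+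
  have disc: "u\<^sup>2 - 4 * (v * w) < 0" using assms(3) by (simp add: mult.assoc)
  consider "\<alpha> > 0" | "\<alpha> = 0" "\<beta> > 0" | "\<alpha> = 0" "\<beta> = 0" using eqs by linarith
  then show ?thesis
  proof cases
    case 1
    \<comment> \<open>\<open>x\<close> and \<open>y\<close> come from expanding with
      \<open>(w\<tau>)\<^sup>2 = - u w\<tau> - v w\<close>. Their vanishing means that the first
      column also determines \<open>H\<^sub>2\<^sub>3\<close>.\<close>
    define x where "x = \<alpha> * \<zeta> - ((\<delta> + u * \<eta>) * \<epsilon> + v * w * \<eta> * \<theta>)"
    define y where "y = \<alpha> * \<iota> - (\<delta> * \<theta> - \<epsilon> * \<eta>)"
    \<comment> \<open>The norm of \<open>H\<^sub>1\<^sub>1 H\<^sub>2\<^sub>3 - H\<^sub>2\<^sub>1 H\<^sub>1\<^sub>3\<close>, which is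
      \<open>H\<^sub>1\<^sub>1\<^sup>2 |H\<^sub>2\<^sub>3|\<^sup>2 - 2 H\<^sub>1\<^sub>1 Re (H\<^sub>1\<^sub>2 H\<^sub>2\<^sub>3 H\<^sub>3\<^sub>1) + |H\<^sub>1\<^sub>2|\<^sup>2 |H\<^sub>1\<^sub>3|\<^sup>2\<close>.\<close>
    have "x\<^sup>2 + u * x * y + v * w * y\<^sup>2 =
        \<alpha>\<^sup>2 * (\<zeta> * (\<zeta> + u * \<iota>) + v * w * \<iota>\<^sup>2)
        - \<alpha> * (\<delta> * (\<epsilon> + u * \<theta>) * \<zeta> + (\<delta> + u * \<eta>) * \<epsilon> * (\<zeta> + u * \<iota>)
          + v * w * ((2 * \<delta> + u * \<eta>) * \<theta> * \<iota> - (2 * \<epsilon> + u * \<theta>) * \<eta> * \<iota>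
                     + (2 * \<zeta> + u * \<iota>) * \<eta> * \<theta>))
        + (\<delta> * (\<delta> + u * \<eta>) + v * w * \<eta>\<^sup>2) * (\<epsilon> * (\<epsilon> + u * \<theta>) + v * w * \<theta>\<^sup>2)"
      unfolding x_def y_def by algebra
    \<comment> \<open>The equations replace squared moduli by products of diagonal entries, and the
      cubic bracket by \<open>2 * \<alpha> * \<beta> * \<gamma>\<close>.\<close>
    also have "\<dots> = \<alpha>\<^sup>2 * (\<beta> * \<gamma>) - \<alpha> * (2 * \<alpha> * \<beta> * \<gamma>) + (\<alpha> * \<beta>) * (\<alpha> * \<gamma>)"
      using eqs by (smt (verit, best))
    also have "\<dots> = 0" by algebra
    finally have "x = 0" "y = 0" using norm_form_eq_0[OF disc] by blast+
    then have H23: "\<alpha> * \<zeta> = (\<delta> + u * \<eta>) * \<epsilon> + v * w * \<eta> * \<theta>" "\<alpha> * \<iota> = \<delta> * \<theta> - \<epsilon> * \<eta>"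
      by (simp_all add: x_def y_def)
    \<comment> \<open>The vector is the first column of \<open>H\<close>; its second entry is
      \<open>H\<^sub>2\<^sub>1 = (\<delta> + u\<eta>) + w\<tau>\<eta>\<close>, the conjugate of
      \<open>\<delta> - w\<tau>\<eta>\<close>.\<close>
    have "forms u v w \<alpha> (\<delta> + u * \<eta>) (\<epsilon> + u * \<theta>) 0 (w * \<eta>) (w * \<theta>) = scale9 (w * \<alpha>) V"
      unfolding V forms.simps scale9.simps prod.inject
      by (intro conjI; ((simp add: power2_eq_square; fail) | algebra | (insert eq1, algebra) | (insert eq3, algebra)
            | (insert H23(1), algebra) | (insert H23(2), algebra)))
    moreover have "w * \<alpha> > 0" using 1 assms(2) by simp
    ultimately show ?thesis by blast
  next
    case 2
    \<comment> \<open>With \<open>\<alpha> = 0\<close> the entries \<open>H\<^sub>1\<^sub>2\<close>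
      and \<open>H\<^sub>1\<^sub>3\<close> have norm 0, so the first row vanishes and the second
      column takes over.\<close>
    then have "\<delta>\<^sup>2 + u * \<delta> * \<eta> + v * w * \<eta>\<^sup>2 = 0" "\<epsilon>\<^sup>2 + u * \<epsilon> * \<theta> + v * w * \<theta>\<^sup>2 = 0"
      using eq1 eq3 by algebra+
    then have 0: "\<delta> = 0" "\<eta> = 0" "\<epsilon> = 0" "\<theta> = 0"
      using norm_form_eq_0[OF disc] by blast+
    have "forms u v w 0 \<beta> (\<zeta> + u * \<iota>) 0 0 (w * \<iota>) = scale9 (w * \<beta>) V"
      unfolding V forms.simps scale9.simps prod.inject 0 \<open>\<alpha> = 0\<close> 
      by (intro conjI; ((simp add: power2_eq_square algebra_simps; fail) | algebra | (insert eq2, algebra)))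
    moreover have "w * \<beta> > 0" using 2 assms(2) by simp
    ultimately show ?thesis by blast
  next
    case 3
    then have "\<delta>\<^sup>2 + u * \<delta> * \<eta> + v * w * \<eta>\<^sup>2 = 0" "\<epsilon>\<^sup>2 + u * \<epsilon> * \<theta> + v * w * \<theta>\<^sup>2 = 0"
      "\<zeta>\<^sup>2 + u * \<zeta> * \<iota> + v * w * \<iota>\<^sup>2 = 0"
      using eq1 eq2 eq3 by algebra+
    then have 0: "\<delta> = 0" "\<eta> = 0" "\<epsilon> = 0" "\<theta> = 0" "\<zeta> = 0" "\<iota> = 0"
      using norm_form_eq_0[OF disc] by blast+
    \<comment> \<open>Only \<open>H\<^sub>3\<^sub>3 = \<gamma>\<close> is left, and it is nonzero
      because \<open>V\<close> is.\<close>
    have "forms u v w 0 0 \<gamma> 0 0 0 = scale9 (w * \<gamma>) V"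
      unfolding V 0 3 by (simp add: power2_eq_square)
    moreover have "w * \<gamma> > 0" using 0 3 V assms(2,4) eqs by (simp add: less_le)
    ultimately show ?thesis by blast
  qed
qed

subsection \<open>Coordinates on the lattice and on its exterior square\<close>

definition lattice_point :: "complex \<Rightarrow> int \<Rightarrow> int \<Rightarrow> int \<Rightarrow> int \<Rightarrow> int \<Rightarrow> int \<Rightarrow> complex ^ 3" where
  "lattice_point \<tau> a b c d e f =
     vector [of_int a + \<tau> * of_int d, of_int b + \<tau> * of_int e, of_int c + \<tau> * of_int f]"

text \<open>Solves \<open>z = p + \<tau> q\<close> for real \<open>p\<close> and \<open>q\<close> in
  each component. On lattice points both are integers, and the floor only changes the type.\<close>

definition lattice_coord :: "complex \<Rightarrow> nat \<Rightarrow> complex ^ 3 \<Rightarrow> int" where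
  "lattice_coord \<tau> k x =
     (let q = (\<lambda>z. \<lfloor>Im z / Im \<tau>\<rfloor>); p = (\<lambda>z. \<lfloor>Re z - Re \<tau> * Im z / Im \<tau>\<rfloor>)
      in [p (x $ 1), p (x $ 2), p (x $ 3), q (x $ 1), q (x $ 2), q (x $ 3)] ! k)"

lemma lattice_coord_point:
  assumes "Im \<tau> > 0"
  shows "lattice_coord \<tau> k (lattice_point \<tau> a b c d e f) = [a, b, c, d, e, f] ! k"
  using assms by (simp add: lattice_coord_def lattice_point_def vector_3)

lemma carrier_Lattice: "carrier (Lattice \<tau>) = {lattice_point \<tau> a b c d e f | a b c d e f. True}"
proof -
  have "\<exists>a b c d e f. (\<chi> i. of_int (m $ i) + \<tau> * of_int (n $ i)) = lattice_point \<tau> a b c d e f"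
    for m n :: "int ^ 3"
    by (intro exI[of _ "m $ 1"] exI[of _ "m $ 2"] exI[of _ "m $ 3"]
        exI[of _ "n $ 1"] exI[of _ "n $ 2"] exI[of _ "n $ 3"])
      (simp add: lattice_point_def vec_eq_iff forall_3 vector_3)
  moreover have "\<exists>m n :: int ^ 3. lattice_point \<tau> a b c d e f = (\<chi> i. of_int (m $ i) + \<tau> * of_int (n $ i))"
    for a b c d e f
    by (intro exI[of _ "vector [a, b, c]"] exI[of _ "vector [d, e, f]"])
      (simp add: lattice_point_def vec_eq_iff forall_3 vector_3)
  ultimately show ?thesis
    by (auto simp: Lattice_def additive_group_def)
qed

lemma lattice_point_in_carrier [simp]: "lattice_point \<tau> a b c d e f \<in> carrier (Lattice \<tau>)"
  unfolding carrier_Lattice by blast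

lemma lattice_point_add:
  "lattice_point \<tau> a b c d e f + lattice_point \<tau> a' b' c' d' e' f'
   = lattice_point \<tau> (a + a') (b + b') (c + c') (d + d') (e + e') (f + f')"
  by (simp add: lattice_point_def vec_eq_iff forall_3 vector_3 algebra_simps)

lemma lattice_point_0: "lattice_point \<tau> 0 0 0 0 0 0 = 0"
  by (simp add: lattice_point_def vec_eq_iff forall_3 vector_3)

lemma mult_Lattice: "x \<otimes>\<^bsub>Lattice \<tau>\<^esub> y = x + y"
  and one_Lattice: "\<one>\<^bsub>Lattice \<tau>\<^esub> = 0"
  by (simp_all add: Lattice_def additive_group_def)

lemma comm_group_additive_group:
  assumes "0 \<in> S" "\<And>x y. \<lbrakk>x \<in> S; y \<in> S\<rbrakk> \<Longrightarrow> x + y \<in> S" "\<And>x. x \<in> S \<Longrightarrow> - x \<in> S"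
  shows "comm_group (additive_group S)"
proof (rule comm_groupI)
  fix x assume "x \<in> carrier (additive_group S)"
  with assms(3) show "\<exists>y\<in>carrier (additive_group S). y \<otimes>\<^bsub>additive_group S\<^esub> x = \<one>\<^bsub>additive_group S\<^esub>"
    by (intro bexI[of _ "- x"]) (simp_all add: additive_group_def)
qed (use assms in \<open>auto simp: additive_group_def ac_simps\<close>)

lemma comm_group_Lattice: "comm_group (Lattice \<tau>)"
proof -
  let ?S = "{lattice_point \<tau> a b c d e f | a b c d e f. True}"
  have "Lattice \<tau> = additive_group ?S"
    using carrier_Lattice[of \<tau>] by (simp add: Lattice_def additive_group_def)
  moreover have "comm_group (additive_group ?S)"
  proof (rule comm_group_additive_group)
    show "0 \<in> ?S" using lattice_point_0[of \<tau>, symmetric] by blast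
    fix x assume "x \<in> ?S"
    then obtain a b c d e f where x: "x = lattice_point \<tau> a b c d e f" by blast
    have "- x = lattice_point \<tau> (- a) (- b) (- c) (- d) (- e) (- f)"
      by (simp add: x minus_unique lattice_point_add lattice_point_0)
    then show "- x \<in> ?S" by blast
  qed (auto simp: lattice_point_add, blast)
  ultimately show ?thesis by simp
qed

lemma less_6_cases: "i < (6::nat) \<Longrightarrow> i = 0 \<or> i = 1 \<or> i = 2 \<or> i = 3 \<or> i = 4 \<or> i = 5"
  by auto

lemma free_coordinates_Lattice:
  assumes "Im \<tau> > 0"
  shows "free_coordinates (Lattice \<tau>) {..<6} (lattice_coord \<tau>)"
proof -
  interpret comm_group "Lattice \<tau>" by (rule comm_group_Lattice)
  note [simp] = lattice_coord_point[OF assms]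
  show ?thesis
  proof unfold_locales
    fix i x y assume "i \<in> {..<6::nat}" "x \<in> carrier (Lattice \<tau>)" "y \<in> carrier (Lattice \<tau>)"
    then show "lattice_coord \<tau> i (x \<otimes>\<^bsub>Lattice \<tau>\<^esub> y) = lattice_coord \<tau> i x + lattice_coord \<tau> i y"
      using less_6_cases[of i] by (auto simp: mult_Lattice carrier_Lattice lattice_point_add)
  next
    fix k :: "nat \<Rightarrow> int"
    show "\<exists>x\<in>carrier (Lattice \<tau>). \<forall>i\<in>{..<6}. lattice_coord \<tau> i x = k i"
      by (rule bexI[of _ "lattice_point \<tau> (k 0) (k 1) (k 2) (k 3) (k 4) (k 5)"])
        (auto dest!: less_6_cases)
  next
    fix x y
    assume x: "x \<in> carrier (Lattice \<tau>)" and y: "y \<in> carrier (Lattice \<tau>)"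
      and eq: "\<And>i. i \<in> {..<6} \<Longrightarrow> lattice_coord \<tau> i x = lattice_coord \<tau> i y"
    obtain a b c d e f where x: "x = lattice_point \<tau> a b c d e f"
      using x unfolding carrier_Lattice by blast
    obtain a' b' c' d' e' f' where y: "y = lattice_point \<tau> a' b' c' d' e' f'"
      using y unfolding carrier_Lattice by blast
    have "[a, b, c, d, e, f] ! i = [a', b', c', d', e', f'] ! i" if "i < 6" for i
      using eq[of i] that by (simp add: x y)
    from this[of 0] this[of 1] this[of 2] this[of 3] this[of 4] this[of 5] show "x = y"
      by (simp add: x y)
  qed
qed

text \<open>Since \<open>w\<tau>\<^sup>2 = - v - u\<tau>\<close>, the product
  \<open>w\<tau> (p + \<tau>q)\<close> is \<open>- vq + \<tau> (wp - uq)\<close>.\<close>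

lemma bar_lattice_point:
  assumes "of_int w * \<tau>\<^sup>2 + of_int u * \<tau> + of_int v = 0"
  shows "bar w \<tau> (lattice_point \<tau> a b c d e f) =
    lattice_point \<tau> (- v * d) (- v * e) (- v * f) (w * a - u * d) (w * b - u * e) (w * c - u * f)"
proof -
  have *: "of_int w * \<tau> * (of_int p + \<tau> * of_int q) = of_int (- v * q) + \<tau> * of_int (w * p - u * q)"
    for p q
  proof -
    have "of_int w * \<tau> * (of_int p + \<tau> * of_int q) - (of_int (- v * q) + \<tau> * of_int (w * p - u * q))
      = of_int q * (of_int w * \<tau>\<^sup>2 + of_int u * \<tau> + of_int v)"
      by (simp add: algebra_simps power2_eq_square)
    then show ?thesis using assms by simp
  qed
  show ?thesis
    unfolding bar_def lattice_point_def
    by (simp only: vec_eq_iff forall_3 vector_3 vector_smult_component * simp_thms)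
qed

text \<open>Only the entries above the diagonal are meaningful.\<close>

fun bivector_coord :: "int \<Rightarrow> int \<Rightarrow> int \<Rightarrow> int9 \<Rightarrow> nat \<times> nat \<Rightarrow> int" where
  "bivector_coord u v w (\<alpha>, \<beta>, \<gamma>, \<delta>, \<epsilon>, \<zeta>, \<eta>, \<theta>, \<iota>) (i, j) =
    [[0, - v * \<eta>, - v * \<theta>, \<alpha>, \<delta>, \<epsilon>],
     [0, 0, - v * \<iota>, \<delta> + u * \<eta>, \<beta>, \<zeta>],
     [0, 0, 0, \<epsilon> + u * \<theta>, \<zeta> + u * \<iota>, \<gamma>],
     [0, 0, 0, 0, - w * \<eta>, - w * \<theta>],
     [0, 0, 0, 0, 0, - w * \<iota>]] ! i ! j"

abbreviation "pairs6 \<equiv> {(i, j). i < j \<and> j < (6::nat)}"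

lemma pairs6: "pairs6 = {(0,1),(0,2),(0,3),(0,4),(0,5),(1,2),(1,3),(1,4),(1,5),
    (2,3),(2,4),(2,5),(3,4),(3,5),(4,5)}" (is "_ = ?R")
proof
  show "pairs6 \<subseteq> ?R"
  proof
    fix p assume "p \<in> pairs6"
    then obtain i j where p: "p = (i, j)" and ij: "i < j" "j < 6" by auto
    then have "i < 6" by simp
    from less_6_cases[OF this] less_6_cases[OF ij(2)] ij(1) show "p \<in> ?R"
      unfolding p by (elim disjE) simp_all
  qed
qed auto

lemma bivector_coord_scale:
  assumes "p \<in> pairs6"
  shows "bivector_coord u v w (scale9 k V) p = k * bivector_coord u v w V p"
proof -
  obtain \<alpha> \<beta> \<gamma> \<delta> \<epsilon> \<zeta> \<eta> \<theta> \<iota> where "V = (\<alpha>, \<beta>, \<gamma>, \<delta>, \<epsilon>, \<zeta>, \<eta>, \<theta>, \<iota>)"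
    by (rule int9_cases)
  with assms show ?thesis
    unfolding pairs6 by (auto simp: algebra_simps)
qed

text \<open>A common divisor of the coordinates divides \<open>\<delta>\<close> and
  \<open>\<delta> + u * \<eta>\<close>, hence \<open>u * \<eta>\<close>, and also
  \<open>v * \<eta>\<close> and \<open>w * \<eta>\<close>; coprimality of \<open>u\<close>,
  \<open>v\<close>, \<open>w\<close> gives \<open>\<eta>\<close>. The same works for
  \<open>\<theta>\<close> and \<open>\<iota>\<close>.\<close>

lemma dvd_bivector_coord_iff:
  assumes "Gcd {u, v, w} = 1"
  shows "(\<forall>p\<in>pairs6. k dvd bivector_coord u v w V p) \<longleftrightarrow> (\<forall>x\<in>entries9 V. k dvd x)"
proof -
  obtain \<alpha> \<beta> \<gamma> \<delta> \<epsilon> \<zeta> \<eta> \<theta> \<iota> where V: "V = (\<alpha>, \<beta>, \<gamma>, \<delta>, \<epsilon>, \<zeta>, \<eta>, \<theta>, \<iota>)"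
    by (rule int9_cases)
  have *: "k dvd x" if "k dvd u * x" "k dvd v * x" "k dvd w * x" for x
  proof -
    have "k dvd Gcd ((\<lambda>y. x * y) ` {u, v, w})"
      by (rule Gcd_greatest) (use that in \<open>auto simp: mult.commute\<close>)
    then show ?thesis using assms by (simp add: Gcd_mult del: Gcd_insert image_insert)
  qed
  show ?thesis
    unfolding V pairs6 using *[of \<eta>] *[of \<theta>] *[of \<iota>]
    by (auto simp: dvd_add_right_iff)
qed

text \<open>The coordinates are the fifteen minors of the matrix with rows the coordinates of
  \<lambda> and of \<open>w\<tau>\<lambda>\<close>.\<close>

lemma wedge_coord_bar_bivector:
  assumes "Im \<tau> > 0" "of_int w * \<tau>\<^sup>2 + of_int u * \<tau> + of_int v = 0" "p \<in> pairs6"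
  shows "wedge_coord (lattice_coord \<tau>) p (bar_bivector w \<tau> (lattice_point \<tau> a b c d e f))
    = bivector_coord u v w (forms u v w a b c d e f) p"
proof -
  interpret finite_free_coordinates "Lattice \<tau>" 6 "lattice_coord \<tau>"
    unfolding finite_free_coordinates_def by (rule free_coordinates_Lattice[OF assms(1)])
  obtain i j where p: "p = (i, j)" "i < 6" "j < 6" using assms(3) by auto
  have "wedge_coord (lattice_coord \<tau>) p (bar_bivector w \<tau> (lattice_point \<tau> a b c d e f))
    = [a, b, c, d, e, f] ! i * [- v * d, - v * e, - v * f, w * a - u * d, w * b - u * e, w * c - u * f] ! j
    - [a, b, c, d, e, f] ! j * [- v * d, - v * e, - v * f, w * a - u * d, w * b - u * e, w * c - u * f] ! i"
    unfolding bar_bivector_def p bar_lattice_point[OF assms(2)]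
    by (subst wedge_coord_wedge) (use p in \<open>auto simp: lattice_coord_point[OF assms(1)]\<close>)
  also have "\<dots> = bivector_coord u v w (forms u v w a b c d e f) p"
    using assms(3) unfolding p pairs6 by (auto simp: algebra_simps power2_eq_square)
  finally show ?thesis .
qed

subsection \<open>Primitivity\<close>

fun int9_coord :: "nat \<Rightarrow> int9 \<Rightarrow> int" where
  "int9_coord i (\<alpha>, \<beta>, \<gamma>, \<delta>, \<epsilon>, \<zeta>, \<eta>, \<theta>, \<iota>) = [\<alpha>, \<beta>, \<gamma>, \<delta>, \<epsilon>, \<zeta>, \<eta>, \<theta>, \<iota>] ! i"

lemma lessThan_9: "{..<9::nat} = {0, 1, 2, 3, 4, 5, 6, 7, 8}"
  by (auto simp: less_Suc_eq numeral_eq_Suc)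

lemma lessThan_6: "{..<6::nat} = {0, 1, 2, 3, 4, 5}"
  by (auto simp: less_Suc_eq numeral_eq_Suc)

lemma free_coordinates_int9: "free_coordinates (additive_group UNIV) {..<9} int9_coord"
proof -
  interpret comm_group "additive_group (UNIV :: int9 set)"
    by (rule comm_group_additive_group) auto
  show ?thesis
  proof unfold_locales
    fix i :: nat and x y :: int9 assume "i \<in> {..<9}"
    then show "int9_coord i (x \<otimes>\<^bsub>additive_group UNIV\<^esub> y) = int9_coord i x + int9_coord i y"
      by (cases x rule: int9_cases; cases y rule: int9_cases) (auto simp: additive_group_def lessThan_9)
  next
    fix k :: "nat \<Rightarrow> int"
    show "\<exists>x\<in>carrier (additive_group UNIV). \<forall>i\<in>{..<9}. int9_coord i x = k i"
      by (rule bexI[of _ "(k 0, k 1, k 2, k 3, k 4, k 5, k 6, k 7, k 8)"])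
        (auto simp: additive_group_def lessThan_9)
  next
    fix x y :: int9
    assume "\<And>i. i \<in> {..<9} \<Longrightarrow> int9_coord i x = int9_coord i y"
    then have "\<forall>i\<in>{0, 1, 2, 3, 4, 5, 6, 7, 8}. int9_coord i x = int9_coord i y"
      unfolding lessThan_9 by blast
    then show "x = y"
      by (cases x rule: int9_cases; cases y rule: int9_cases) simp
  qed
qed

lemma primitive_int9_iff: "primitive (additive_group UNIV) V \<longleftrightarrow> Gcd (entries9 V) = 1"
proof -
  have "(\<lambda>i. int9_coord i V) ` {..<9} = entries9 V"
    unfolding lessThan_9 by (cases V rule: int9_cases) simp
  then show ?thesis
    using free_coordinates.primitive_iff_Gcd[OF free_coordinates_int9, of V]
    by (simp add: additive_group_def)
qed

lemma primitive_Lattice_iff: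
  assumes "Im \<tau> > 0"
  shows "primitive (Lattice \<tau>) (lattice_point \<tau> a b c d e f) \<longleftrightarrow> Gcd {a, b, c, d, e, f} = 1"
proof -
  have "(\<lambda>i. lattice_coord \<tau> i (lattice_point \<tau> a b c d e f)) ` {..<6} = {a, b, c, d, e, f}"
    unfolding lessThan_6 by (simp add: lattice_coord_point[OF assms])
  then show ?thesis
    using free_coordinates.primitive_iff_Gcd[OF free_coordinates_Lattice[OF assms] lattice_point_in_carrier]
    by metis
qed

lemma Gcd_entries9_scale: "Gcd (entries9 (scale9 k V)) = \<bar>k\<bar> * Gcd (entries9 V)"
proof -
  have "entries9 (scale9 k V) = (*) k ` entries9 V"
    by (cases V rule: int9_cases) simp
  then show ?thesis
    by (simp add: Gcd_mult abs_mult)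
qed

text \<open>Taking gcds of the entries gives \<open>p = q\<close>, which then cancels.\<close>

lemma scale9_primitive_unique:
  assumes "scale9 p V = scale9 q V'" "Gcd (entries9 V) = 1" "Gcd (entries9 V') = 1" "p > 0" "q > 0"
  shows "V = V'"
proof -
  have "p = q"
    using arg_cong[OF assms(1), of "\<lambda>V. Gcd (entries9 V)"] assms(2-5)
    by (simp add: Gcd_entries9_scale)
  with assms(1,4) show ?thesis by (cases V rule: int9_cases; cases V' rule: int9_cases) simp
qed

section \<open>Reduced bivectors and their nine parameters\<close>

lemma dvd_entries9_imp_scale9:
  assumes "\<forall>x\<in>entries9 F. k dvd x"
  shows "\<exists>V. F = scale9 k V"
proof -
  obtain \<alpha> \<beta> \<gamma> \<delta> \<epsilon> \<zeta> \<eta> \<theta> \<iota> where F: "F = (\<alpha>, \<beta>, \<gamma>, \<delta>, \<epsilon>, \<zeta>, \<eta>, \<theta>, \<iota>)"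
    by (rule int9_cases)
  have "F = scale9 k (\<alpha> div k, \<beta> div k, \<gamma> div k, \<delta> div k, \<epsilon> div k, \<zeta> div k, \<eta> div k, \<theta> div k, \<iota> div k)"
    using assms unfolding F by simp
  then show ?thesis by blast
qed

text \<open>The content of the bivector is the gcd of the nine forms. Dividing by it therefore
  leaves a primitive \<open>V\<close>, which describes the reduced bivector.\<close>

lemma reduced_bivector_coords:
  assumes \<tau>: "Im \<tau> > 0" "of_int w * \<tau>\<^sup>2 + of_int u * \<tau> + of_int v = 0"
    and uvw: "w > 0" "Gcd {u, v, w} = 1" "u\<^sup>2 - 4 * v * w < 0"
    and prim: "primitive (Lattice \<tau>) (lattice_point \<tau> a b c d e f)"
  defines "l \<equiv> lattice_point \<tau> a b c d e f"
  obtains V where "reduced_bivector w \<tau> l \<in> carrier (exterior_square (Lattice \<tau>))"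
    and "bar_content w \<tau> l > 0"
    and "forms u v w a b c d e f = scale9 (int (bar_content w \<tau> l)) V"
    and "Gcd (entries9 V) = 1"
    and "\<forall>p\<in>pairs6.
      wedge_coord (lattice_coord \<tau>) p (reduced_bivector w \<tau> l) = bivector_coord u v w V p"
proof -
  interpret L: finite_free_coordinates "Lattice \<tau>" 6 "lattice_coord \<tau>"
    unfolding finite_free_coordinates_def by (rule free_coordinates_Lattice[OF \<tau>(1)])
  interpret E: free_coordinates "exterior_square (Lattice \<tau>)" pairs6 "wedge_coord (lattice_coord \<tau>)"
    by (rule L.free_coordinates_exterior_square)
  let ?B = "bar_bivector w \<tau> l" and ?r = "int (bar_content w \<tau> l)" and ?F = "forms u v w a b c d e f"
  have B: "?B \<in> carrier (exterior_square (Lattice \<tau>))"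
    unfolding bar_bivector_def l_def bar_lattice_point[OF \<tau>(2)]
    by (intro L.wedge_in_carrier lattice_point_in_carrier)
  note B_coord = wedge_coord_bar_bivector[OF \<tau>, of _ a b c d e f, folded l_def]
  have B1: "?B \<noteq> \<one>\<^bsub>exterior_square (Lattice \<tau>)\<^esub>"
  proof
    assume "?B = \<one>\<^bsub>exterior_square (Lattice \<tau>)\<^esub>"
    \<comment> \<open>Divisibility by 0 expresses vanishing, so the criterion for common divisors
      applies.\<close>
    then have "\<forall>p\<in>pairs6. 0 dvd bivector_coord u v w ?F p"
      using E.coord_eq_one_iff[OF B] B_coord by simp
    then have "\<forall>x\<in>entries9 ?F. 0 dvd x"
      using dvd_bivector_coord_iff[OF uvw(2)] by blast
    then have "?F = (0, 0, 0, 0, 0, 0, 0, 0, 0)"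
      by (simp del: forms.simps add: forms.simps)
    then have "a = 0 \<and> b = 0 \<and> c = 0 \<and> d = 0 \<and> e = 0 \<and> f = 0"
      by (rule forms_eq_0[OF uvw(1,3)])
    with prim show False
      by (simp add: primitive_def lattice_point_0 one_Lattice)
  qed
  have dvd_r: "k dvd ?r \<longleftrightarrow> (\<forall>x\<in>entries9 ?F. k dvd x)" for k
    unfolding bar_content_def E.dvd_integral_content_iff[OF B B1]
      dvd_bivector_coord_iff[OF uvw(2), symmetric]
    using B_coord by simp
  then have "\<exists>V. ?F = scale9 ?r V"
    by (intro dvd_entries9_imp_scale9) (simp only: dvd_refl flip: dvd_r)
  then obtain V where V: "?F = scale9 ?r V" ..
  note red = E.exact_quotient_content[OF B B1, folded bar_content_def, folded reduced_bivector_def]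
  \<comment> \<open>This product divides all nine forms, hence divides their gcd \<open>?r\<close>;
    cancelling \<open>?r\<close> leaves gcd 1 for \<open>V\<close>.\<close>
  have "?r * Gcd (entries9 V) dvd ?r"
    unfolding dvd_r
  proof
    fix x assume "x \<in> entries9 ?F"
    then have "Gcd (entries9 (scale9 ?r V)) dvd x" unfolding V by (rule Gcd_dvd)
    then show "?r * Gcd (entries9 V) dvd x" by (simp add: Gcd_entries9_scale)
  qed
  then have "Gcd (entries9 V) dvd 1" using red(1) by simp
  then have "Gcd (entries9 V) = 1"
    using Gcd_int_greater_eq_0[of "entries9 V"] by (simp add: zdvd1_eq)
  moreover have "wedge_coord (lattice_coord \<tau>) p (reduced_bivector w \<tau> l) = bivector_coord u v w V p"
    if p: "p \<in> pairs6" for p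
  proof -
    have "?r * wedge_coord (lattice_coord \<tau>) p (reduced_bivector w \<tau> l) = ?r * bivector_coord u v w V p"
      using red(3)[OF p] B_coord[OF p] bivector_coord_scale[OF p] V by simp
    then show ?thesis using red(1) by simp
  qed
  ultimately show ?thesis using that red(1,2) V by blast
qed

text \<open>A left inverse of \<open>bivector_coord\<close> for \<open>w > 0\<close>. The last three
  parameters occur there only with factors, and the one removed here is \<open>- w\<close>.\<close>

definition bivector_params :: "int \<Rightarrow> (nat \<times> nat \<Rightarrow> int) \<Rightarrow> int9" where
  "bivector_params w C =
    (C (0, 3), C (1, 4), C (2, 5), C (0, 4), C (0, 5), C (1, 5),
     (- C (3, 4)) div w, (- C (3, 5)) div w, (- C (4, 5)) div w)"

lemma bivector_params_coord:
  assumes "w > 0" "\<And>p. p \<in> pairs6 \<Longrightarrow> C p = bivector_coord u v w V p"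
  shows "bivector_params w C = V"
  using assms(1) unfolding bivector_params_def by (cases V rule: int9_cases) (simp add: assms(2))

lemma primitive_multiple:
  fixes a b c d e f :: int
  assumes "\<not> (a = 0 \<and> b = 0 \<and> c = 0 \<and> d = 0 \<and> e = 0 \<and> f = 0)"
  obtains k a' b' c' d' e' f' where "k > 0" "Gcd {a', b', c', d', e', f'} = 1"
    "a = k * a'" "b = k * b'" "c = k * c'" "d = k * d'" "e = k * e'" "f = k * f'"
proof -
  define k where "k = Gcd {a, b, c, d, e, f}"
  have "k > 0"
    using assms Gcd_int_greater_eq_0[of "{a, b, c, d, e, f}"] Gcd_0_iff[of "{a, b, c, d, e, f}"]
    unfolding k_def by (auto simp: less_le simp del: Gcd_insert)
  have "k dvd x" if "x \<in> {a, b, c, d, e, f}" for x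
    unfolding k_def using that by (rule Gcd_dvd)
  then have "a = k * (a div k)" "b = k * (b div k)" "c = k * (c div k)"
    "d = k * (d div k)" "e = k * (e div k)" "f = k * (f div k)"
    by simp_all
  then obtain a' b' c' d' e' f' where eqs:
    "a = k * a'" "b = k * b'" "c = k * c'" "d = k * d'" "e = k * e'" "f = k * f'"
    by blast
  have "{a, b, c, d, e, f} = (*) k ` {a', b', c', d', e', f'}" using eqs by simp
  then have "k = k * Gcd {a', b', c', d', e', f'}"
    using \<open>k > 0\<close> Gcd_int_greater_eq_0[of "{a', b', c', d', e', f'}"]
    by (metis k_def Gcd_mult abs_of_nonneg mult_nonneg_nonneg normalize_int_def less_imp_le)
  then have "Gcd {a', b', c', d', e', f'} = 1" using \<open>k > 0\<close> by simp
  with that eqs \<open>k > 0\<close> show ?thesis by blast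
qed

theorem theorem4p4:
  fixes \<tau> :: complex and u v w :: int
  assumes "Im \<tau> > 0"
    and "of_int w * \<tau>\<^sup>2 + of_int u * \<tau> + of_int v = 0"
    and "w > 0"
    and "Gcd {u, v, w} = 1"
    and "u\<^sup>2 - 4 * v * w < 0"
  shows "\<exists>\<Phi> :: ((complex ^ 3) \<times> (complex ^ 3) \<Rightarrow>\<^sub>0 int) set \<Rightarrow> int9.
    bij_betw \<Phi> {reduced_bivector w \<tau> l | l. primitive (Lattice \<tau>) l} (parameter_vectors u v w) \<and>
    (\<forall>(a::int) (b::int) (c::int) (d::int) (e::int) (f::int) l r \<alpha> \<beta> \<gamma> \<delta> \<epsilon> \<zeta> \<eta> \<theta> \<iota>.
       l = vector [of_int a + \<tau> * of_int d, of_int b + \<tau> * of_int e, of_int c + \<tau> * of_int f] \<and>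
       primitive (Lattice \<tau>) l \<and>
       r = int (bar_content w \<tau> l) \<and>
       \<Phi> (reduced_bivector w \<tau> l) = (\<alpha>, \<beta>, \<gamma>, \<delta>, \<epsilon>, \<zeta>, \<eta>, \<theta>, \<iota>) \<longrightarrow>
         r * \<alpha> = w * a\<^sup>2 - u * a * d + v * d\<^sup>2 \<and>
         r * \<beta> = w * b\<^sup>2 - u * b * e + v * e\<^sup>2 \<and>
         r * \<gamma> = w * c\<^sup>2 - u * c * f + v * f\<^sup>2 \<and>
         r * \<delta> = w * a * b - u * a * e + v * d * e \<and>
         r * \<epsilon> = w * a * c - u * a * f + v * d * f \<and>
         r * \<zeta> = w * b * c - u * b * f + v * e * f \<and>
         r * \<eta> = a * e - b * d \<and>
         r * \<theta> = a * f - c * d \<and>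
         r * \<iota> = b * f - c * e)"
proof -
  interpret L: finite_free_coordinates "Lattice \<tau>" 6 "lattice_coord \<tau>"
    unfolding finite_free_coordinates_def by (rule free_coordinates_Lattice[OF assms(1)])
  interpret E: free_coordinates "exterior_square (Lattice \<tau>)" pairs6 "wedge_coord (lattice_coord \<tau>)"
    by (rule L.free_coordinates_exterior_square)
  \<comment> \<open>\<Phi> reads the parameters off the bivector itself, so it cannot depend on the
    choice of \<lambda>.\<close>
  define \<Phi> where "\<Phi> S = bivector_params w (\<lambda>p. wedge_coord (lattice_coord \<tau>) p S)" for S
  let ?R = "{reduced_bivector w \<tau> l | l. primitive (Lattice \<tau>) l}"
  have coords: "reduced_bivector w \<tau> l \<in> carrier (exterior_square (Lattice \<tau>))"
      "bar_content w \<tau> l > 0"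
      "forms u v w a b c d e f = scale9 (int (bar_content w \<tau> l)) (\<Phi> (reduced_bivector w \<tau> l))"
      "Gcd (entries9 (\<Phi> (reduced_bivector w \<tau> l))) = 1"
      "p \<in> pairs6 \<Longrightarrow> wedge_coord (lattice_coord \<tau>) p (reduced_bivector w \<tau> l)
         = bivector_coord u v w (\<Phi> (reduced_bivector w \<tau> l)) p"
    if prim: "primitive (Lattice \<tau>) l" and l: "l = lattice_point \<tau> a b c d e f" for l a b c d e f p
  proof -
    obtain V where V: "reduced_bivector w \<tau> l \<in> carrier (exterior_square (Lattice \<tau>))"
      "bar_content w \<tau> l > 0"
      "forms u v w a b c d e f = scale9 (int (bar_content w \<tau> l)) V"
      "Gcd (entries9 V) = 1"
      "\<forall>p\<in>pairs6.
        wedge_coord (lattice_coord \<tau>) p (reduced_bivector w \<tau> l) = bivector_coord u v w V p"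
      by (rule reduced_bivector_coords[OF assms, of a b c d e f, folded l, OF prim]) (rule that)
    have \<Phi>V: "\<Phi> (reduced_bivector w \<tau> l) = V"
      unfolding \<Phi>_def by (rule bivector_params_coord[OF assms(3) bspec[OF V(5)]])
    show "reduced_bivector w \<tau> l \<in> carrier (exterior_square (Lattice \<tau>))"
      "bar_content w \<tau> l > 0"
      "forms u v w a b c d e f = scale9 (int (bar_content w \<tau> l)) (\<Phi> (reduced_bivector w \<tau> l))"
      "Gcd (entries9 (\<Phi> (reduced_bivector w \<tau> l))) = 1"
      "p \<in> pairs6 \<Longrightarrow> wedge_coord (lattice_coord \<tau>) p (reduced_bivector w \<tau> l)
         = bivector_coord u v w (\<Phi> (reduced_bivector w \<tau> l)) p"
      unfolding \<Phi>V by (rule V(1-4) | erule bspec[OF V(5)])+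
  qed
  have primitive_cases: "\<exists>a b c d e f. l = lattice_point \<tau> a b c d e f"
    if "primitive (Lattice \<tau>) l" for l
    using that carrier_Lattice unfolding primitive_def by blast
  have "inj_on \<Phi> ?R"
  proof (rule inj_onI)
    fix S S' assume "S \<in> ?R" "S' \<in> ?R" and eq: "\<Phi> S = \<Phi> S'"
    then obtain l l' where l: "S = reduced_bivector w \<tau> l" "primitive (Lattice \<tau>) l"
      and l': "S' = reduced_bivector w \<tau> l'" "primitive (Lattice \<tau>) l'" by blast
    obtain a b c d e f where "l = lattice_point \<tau> a b c d e f"
      using primitive_cases[OF l(2)] by blast
    note S = coords(1,5)[OF l(2) this, folded l(1)]
    obtain a b c d e f where "l' = lattice_point \<tau> a b c d e f"
      using primitive_cases[OF l'(2)] by blast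
    note S' = coords(1,5)[OF l'(2) this, folded l'(1)]
    \<comment> \<open>All fifteen coordinates are functions of the nine parameters.\<close>
    show "S = S'"
      by (rule E.coord_inj[OF S(1) S'(1)]) (simp only: S(2) S'(2) eq)
  qed
  moreover have "\<Phi> ` ?R = parameter_vectors u v w"
  proof
    show "\<Phi> ` ?R \<subseteq> parameter_vectors u v w"
    proof (rule image_subsetI)
      fix S assume "S \<in> ?R"
      then obtain l where Sl: "S = reduced_bivector w \<tau> l" and l: "primitive (Lattice \<tau>) l"
        by blast
      obtain a b c d e f where "l = lattice_point \<tau> a b c d e f"
        using primitive_cases[OF l] by blast
      note S = coords(2-4)[OF l this, folded Sl]
      have "rank_one_eqs u v w (\<Phi> S)"
        using rank_one_eqs_scaleD rank_one_eqs_forms[OF assms(3,5)] S(1,2)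
        by (metis of_nat_0_less_iff)
      with S(3) show "\<Phi> S \<in> parameter_vectors u v w"
        by (simp add: parameter_vectors_eq primitive_int9_iff)
    qed
    show "parameter_vectors u v w \<subseteq> \<Phi> ` ?R"
    proof
      fix V assume "V \<in> parameter_vectors u v w"
      then have V: "Gcd (entries9 V) = 1" "rank_one_eqs u v w V"
        by (simp_all add: parameter_vectors_eq primitive_int9_iff)
      then have V0: "V \<noteq> (0, 0, 0, 0, 0, 0, 0, 0, 0)" by auto
      obtain a b c d e f s where s: "s > 0" "forms u v w a b c d e f = scale9 s V"
        using rank_one_vector[OF V(2) assms(3,5) V0] by blast
      have "\<not> (a = 0 \<and> b = 0 \<and> c = 0 \<and> d = 0 \<and> e = 0 \<and> f = 0)"
      proof
        assume "a = 0 \<and> b = 0 \<and> c = 0 \<and> d = 0 \<and> e = 0 \<and> f = 0"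
        then have "scale9 s V = (0, 0, 0, 0, 0, 0, 0, 0, 0)" using s(2) by simp
        with s(1) V0 show False by (cases V rule: int9_cases) simp
      qed
      \<comment> \<open>The vector found need not be primitive, so its content \<open>k\<close> is
        divided out.\<close>
      then obtain k a' b' c' d' e' f' where k: "k > 0" "Gcd {a', b', c', d', e', f'} = 1"
        "a = k * a'" "b = k * b'" "c = k * c'" "d = k * d'" "e = k * e'" "f = k * f'"
        by (rule primitive_multiple)
      define l where "l = lattice_point \<tau> a' b' c' d' e' f'"
      have l: "primitive (Lattice \<tau>) l"
        unfolding l_def primitive_Lattice_iff[OF assms(1)] by (rule k(2))
      note S = coords[OF l l_def]
      \<comment> \<open>The forms are quadratic, so \<open>k\<close> enters squared.
        \<open>V\<close> and the image under \<Phi> become primitive vectors with a common positive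
        multiple, hence equal.\<close>
      have "scale9 s V = scale9 (k\<^sup>2) (scale9 (int (bar_content w \<tau> l)) (\<Phi> (reduced_bivector w \<tau> l)))"
        unfolding s(2)[symmetric] S(3)[symmetric] k(3-8) by (rule forms_scale)
      also have "\<dots> = scale9 (k\<^sup>2 * int (bar_content w \<tau> l)) (\<Phi> (reduced_bivector w \<tau> l))"
        by (cases "\<Phi> (reduced_bivector w \<tau> l)" rule: int9_cases) (simp add: mult.assoc)
      finally have "V = \<Phi> (reduced_bivector w \<tau> l)"
        by (rule scale9_primitive_unique[OF _ V(1) S(4) s(1)]) (use k(1) S(2) in simp)
      with l show "V \<in> \<Phi> ` ?R" by blast
    qed
  qed
  ultimately have "bij_betw \<Phi> ?R (parameter_vectors u v w)"
    by (simp add: bij_betw_def)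
  moreover have "r * \<alpha> = w * a\<^sup>2 - u * a * d + v * d\<^sup>2 \<and>
         r * \<beta> = w * b\<^sup>2 - u * b * e + v * e\<^sup>2 \<and>
         r * \<gamma> = w * c\<^sup>2 - u * c * f + v * f\<^sup>2 \<and>
         r * \<delta> = w * a * b - u * a * e + v * d * e \<and>
         r * \<epsilon> = w * a * c - u * a * f + v * d * f \<and>
         r * \<zeta> = w * b * c - u * b * f + v * e * f \<and>
         r * \<eta> = a * e - b * d \<and>
         r * \<theta> = a * f - c * d \<and>
         r * \<iota> = b * f - c * e"
    if "l = vector [of_int a + \<tau> * of_int d, of_int b + \<tau> * of_int e, of_int c + \<tau> * of_int f] \<and>
       primitive (Lattice \<tau>) l \<and> r = int (bar_content w \<tau> l) \<and>
       \<Phi> (reduced_bivector w \<tau> l) = (\<alpha>, \<beta>, \<gamma>, \<delta>, \<epsilon>, \<zeta>, \<eta>, \<theta>, \<iota>)"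
    for a b c d e f l r \<alpha> \<beta> \<gamma> \<delta> \<epsilon> \<zeta> \<eta> \<theta> \<iota>
  proof -
    have l: "primitive (Lattice \<tau>) l" "l = lattice_point \<tau> a b c d e f"
      and r: "r = int (bar_content w \<tau> l)"
      and \<Phi>l: "\<Phi> (reduced_bivector w \<tau> l) = (\<alpha>, \<beta>, \<gamma>, \<delta>, \<epsilon>, \<zeta>, \<eta>, \<theta>, \<iota>)"
      using that unfolding lattice_point_def by blast+
    from coords(3)[OF l, folded r, unfolded \<Phi>l forms.simps scale9.simps prod.inject]
    show ?thesis by (elim conjE) (intro conjI; erule sym)
  qed
  ultimately show ?thesis by blast
qed

end
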